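(* Let $d\in\mathbb{N}$ and let $(S_t)_{t\geq 0}$ be the Gauß–Weierstraß semigroup on $C_b(\mathbb{R}^d)$, i.e. $S_0f:=f$ and $S_tf:=k_t*f$ for $t>0$ and $f\in C_b(\mathbb{R}^d)$, where $k_t(x):=(4\pi t)^{-d/2}e^{-|x|^2/(4t)}$ for $x\in\mathbb{R}^d$. Let $\Omega\subseteq\mathbb{R}^d$ be thick and let $C:C_b(\mathbb{R}^d)\to C_b(\Omega)$, $Cf:=f|_\Omega$. Then for every $T>0$ and $r\in[1,\infty]$ there exists $C_{\mathrm{obs}}\geq 0$ such that for all $f\in C_b(\mathbb{R}^d)$ $$\|S_Tf\|_{C_b(\mathbb{R}^d)}\leq\begin{cases} C_{\mathrm{obs}}\left(\int_0^T\|CS_tf\|_{C_b(\Omega)}^r\,\mathrm{d}t\right)^{1/r} & \text{if } r\in[1,\infty),\\ C_{\mathrm{obs}}\,\operatorname{ess\,sup}_{t\in[0,T]}\|CS_tf\|_{C_b(\Omega)} & \text{if } r=\infty.\end{cases}$$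
   Context: $C_b(Z)$ denotes the space of bounded continuous scalar-valued functions on $Z$ with the supremum norm. A set $\Omega\subseteq\mathbb{R}^d$ is called thick if $\Omega$ is (Lebesgue) measurable and there exist $L=(L_1,\dots,L_d)\in(0,\infty)^d$ and $\rho\in(0,1]$ such that $\lambda^d(\Omega\cap(x+(0,L)))\geq\rho\,\lambda^d((0,L))$ for all $x\in\mathbb{R}^d$, where $\lambda^d$ is $d$-dimensional Lebesgue measure and $(0,L):=\prod_{j=1}^d(0,L_j)$. *)

theory Defs
  imports "HOL-Analysis.Analysis" "HOL-Probability.Probability"
begin

definition thick :: "(real ^ 'd) set \<Rightarrow> bool" where
  "thick \<Omega> \<longleftrightarrow>
     \<Omega> \<in> sets lebesgue \<and>
     (\<exists>L :: real ^ 'd. \<exists>\<rho> :: real.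
        (\<forall>j. 0 < L $ j) \<and> 0 < \<rho> \<and> \<rho> \<le> 1 \<and>
        (\<forall>x. measure lebesgue (\<Omega> \<inter> (+) x ` box 0 L) \<ge> \<rho> * measure lebesgue (box 0 L)))"


text \<open>
  The type of bounded continuous functions from the library covers functions on a whole type.
  Functions on a subset \<open>Z\<close> are represented extensionally, i.e. they are \<open>undefined\<close> outside \<open>Z\<close>.
\<close>

definition Cb :: "'a::topological_space set \<Rightarrow> ('a \<Rightarrow> 'b::real_normed_vector) set" where
  "Cb Z = {g \<in> extensional Z. continuous_on Z g \<and> bounded (g ` Z)}"

definition Cb_norm :: "'a set \<Rightarrow> ('a \<Rightarrow> 'b::real_normed_vector) \<Rightarrow> real" where
  "Cb_norm Z g = (SUP z\<in>Z. norm (g z))"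

definition obs :: "'a::topological_space set \<Rightarrow> ('a \<Rightarrow>\<^sub>C 'b::real_normed_vector) \<Rightarrow> 'a \<Rightarrow> 'b" where
  "obs \<Omega> f = restrict (apply_bcontfun f) \<Omega>"

lemma obs_in_Cb: "obs \<Omega> f \<in> Cb \<Omega>"
proof -
  have "bounded (apply_bcontfun f ` \<Omega>)"
    by (rule bounded_subset[OF bounded_apply_bcontfun]) auto
  moreover have "continuous_on \<Omega> (obs \<Omega> f)"
    by (rule continuous_on_eq[of \<Omega> "apply_bcontfun f"]) (auto simp: obs_def)
  ultimately show ?thesis
    by (auto simp: Cb_def obs_def)
qed

lemma Cb_norm_UNIV: "Cb_norm UNIV (apply_bcontfun f) = norm f"
  by (simp add: Cb_norm_def norm_bcontfun_def dist_bcontfun.rep_eq)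


definition heat_kernel :: "real \<Rightarrow> real ^ 'd \<Rightarrow> real" where
  "heat_kernel t x =
     (4 * pi * t) powr (- (real CARD('d) / 2)) * exp (- (norm x)\<^sup>2 / (4 * t))"

definition conv :: "('a::euclidean_space \<Rightarrow> real) \<Rightarrow> ('a \<Rightarrow> 'b) \<Rightarrow> 'a \<Rightarrow> 'b::euclidean_space" where
  "conv k f x = (\<integral>y. k (x - y) *\<^sub>R f y \<partial>lborel)"

definition gauss_weierstrass ::
  "real \<Rightarrow> ((real ^ 'd) \<Rightarrow>\<^sub>C 'b::euclidean_space) \<Rightarrow> ((real ^ 'd) \<Rightarrow>\<^sub>C 'b)" where
  "gauss_weierstrass t f =
     (if t > 0 then Bcontfun (conv (heat_kernel t) (apply_bcontfun f)) else f)"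

text \<open>
  \<open>Bcontfun\<close> is only meaningful on functions in \<open>bcontfun\<close>; that the convolution belongs there
  is shown below, leading to \<open>gauss_weierstrass_apply\<close>.
\<close>

lemma integrable_heat_kernel:
  assumes "t > 0"
  shows "integrable lborel (heat_kernel t :: real ^ 'd \<Rightarrow> real)"
proof -
  let ?g = "\<lambda>x::real. exp (- x\<^sup>2 / (4 * t))"
  interpret product_sigma_finite "\<lambda>_::real^'d. lborel :: real measure" ..
  have "integrable lborel (\<lambda>x. (sqrt (2 * pi * (sqrt (2 * t))\<^sup>2)) * normal_density 0 (sqrt (2 * t)) x)"
    using assms by (intro integrable_mult_right integrable_normal_density) auto
  also have "(\<lambda>x. (sqrt (2 * pi * (sqrt (2 * t))\<^sup>2)) * normal_density 0 (sqrt (2 * t)) x) = ?g"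
    using assms by (auto simp: normal_density_def)
  finally have g: "integrable lborel ?g" .
  have "integrable (\<Pi>\<^sub>M b\<in>(Basis :: (real^'d) set). lborel) (\<lambda>x. \<Prod>b\<in>Basis. ?g (x b))"
    using g by (intro product_integrable_prod) auto
  also have "(\<lambda>x. \<Prod>b\<in>Basis. ?g (x b)) =
      (\<lambda>x. exp (- (norm (\<Sum>b\<in>(Basis :: (real^'d) set). x b *\<^sub>R b))\<^sup>2 / (4 * t)))" (is "?l = ?r")
  proof
    fix x :: "real^'d \<Rightarrow> real"
    have "(norm (\<Sum>b\<in>(Basis :: (real^'d) set). x b *\<^sub>R b))\<^sup>2 = (\<Sum>b\<in>Basis. (x b)\<^sup>2)"
      by (subst power2_norm_eq_inner, subst euclidean_inner) (simp add: power2_eq_square)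
    then show "?l x = ?r x"
      by (simp add: exp_sum[symmetric] sum_negf sum_divide_distrib)
  qed
  finally have "integrable lborel (\<lambda>x::real^'d. exp (- (norm x)\<^sup>2 / (4 * t)))"
    by (subst lborel_eq, subst integrable_distr_eq) auto
  then show ?thesis
    unfolding heat_kernel_def by (intro integrable_mult_right)
qed

lemma conv_commute: "conv k f x = (\<integral>y. k y *\<^sub>R f (x - y) \<partial>lborel)"
proof (cases "(\<lambda>y. k (x - y) *\<^sub>R f y) \<in> borel_measurable borel")
  case True
  have "lborel = distr lborel borel (\<lambda>y. x - y)"
    using lborel_affine[of "-1" x] by (simp add: density_1)
  then have "conv k f x = (\<integral>y. k (x - y) *\<^sub>R f y \<partial>distr lborel borel (\<lambda>y. x - y))"
    unfolding conv_def by simp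
  also have "\<dots> = (\<integral>y. k y *\<^sub>R f (x - y) \<partial>lborel)"
    using True by (subst integral_distr) auto
  finally show ?thesis .
next
  case False
  have "(\<lambda>y. k y *\<^sub>R f (x - y)) \<notin> borel_measurable borel"
  proof
    assume "(\<lambda>y. k y *\<^sub>R f (x - y)) \<in> borel_measurable borel"
    then have "(\<lambda>y. k y *\<^sub>R f (x - y)) \<circ> (\<lambda>y. x - y) \<in> borel_measurable borel"
      by (rule measurable_comp[rotated]) auto
    with False show False by (simp add: o_def)
  qed
  with False show ?thesis
    unfolding conv_def by (metis borel_measurable_integrable measurable_lborel2 not_integrable_integral_eq)
qed

lemma conv_in_bcontfun:
  fixes k :: "'a::euclidean_space \<Rightarrow> real" and f :: "'a \<Rightarrow>\<^sub>C 'b::euclidean_space"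
  assumes k: "integrable lborel k"
  shows "conv k (apply_bcontfun f) \<in> bcontfun"
proof (rule bcontfun_normI)
  have [measurable]: "k \<in> borel_measurable borel"
    using k by auto
  have [measurable]: "apply_bcontfun f \<in> borel_measurable borel"
    by (intro borel_measurable_continuous_onI) auto
  have bound: "norm (k y *\<^sub>R f (x - y)) \<le> norm (k y) * norm f" for x y
    by (auto intro!: mult_left_mono norm_bounded)
  have int: "integrable lborel (\<lambda>y. norm (k y) * norm f)"
    using k by (intro integrable_mult_left integrable_norm)
  show "continuous_on UNIV (conv k (apply_bcontfun f))"
    unfolding continuous_on_sequentially
  proof (intro allI ballI impI, elim conjE)
    fix u :: "nat \<Rightarrow> 'a" and x assume u: "u \<longlonglongrightarrow> x"
    have "(\<lambda>n. \<integral>y. k y *\<^sub>R f (u n - y) \<partial>lborel) \<longlonglongrightarrow> (\<integral>y. k y *\<^sub>R f (x - y) \<partial>lborel)"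
    proof (rule integral_dominated_convergence[OF _ _ int])
      have "(\<lambda>n. k y *\<^sub>R f (u n - y)) \<longlonglongrightarrow> k y *\<^sub>R f (x - y)" for y
        using u by (intro tendsto_intros continuous_on_tendsto_compose[of UNIV f]) auto
      then show "AE y in lborel. (\<lambda>n. k y *\<^sub>R f (u n - y)) \<longlonglongrightarrow> k y *\<^sub>R f (x - y)"
        by simp
    qed (use bound in auto)
    then show "(conv k (apply_bcontfun f) \<circ> u) \<longlonglongrightarrow> conv k (apply_bcontfun f) x"
      by (simp add: conv_commute o_def)
  qed
  show "norm (conv k (apply_bcontfun f) x) \<le> (\<integral>y. norm (k y) * norm f \<partial>lborel)" for x
    unfolding conv_commute using bound int
    by (intro Bochner_Integration.integral_norm_bound_integral Bochner_Integration.integrable_bound[OF int]) auto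
qed

lemma gauss_weierstrass_apply:
  "apply_bcontfun (gauss_weierstrass t f) =
     (if t > 0 then conv (heat_kernel t) (apply_bcontfun f) else apply_bcontfun f)"
  by (simp add: gauss_weierstrass_def Bcontfun_inverse conv_in_bcontfun integrable_heat_kernel)

end

theory Submission
  imports Defs
begin

text \<open>
  Write \<open>S\<^sub>t\<close> for the semigroup. By thickness, every \<open>x\<close> is the endpoint of a segment \<open>{x + s v | 0 \<le> s \<le> 1}\<close>
  of bounded length that meets \<open>\<Omega>\<close> in a set of parameters of length at least \<open>\<delta>\<close>. Pick \<open>2M\<close> well separated
  such parameters \<open>s\<^sub>i\<close> and extrapolate to \<open>s = 0\<close> by Lagrange interpolation; the weights \<open>w\<^sub>i\<close> sum up to at most
  \<open>\<Lambda>\<^sup>M\<close>. On a line the heat kernel is the exponential of a quadratic polynomial, so by Taylor's formula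
  the extrapolation error is at most \<open>\<Lambda>\<^sup>M r\<^sup>-\<^sup>M exp (C r\<^sup>2 / t)\<close> times another Gaussian, with \<open>r \<ge> 1\<close> arbitrary.
  Integrating against \<open>f\<close>, for all \<open>M\<close> and \<open>r\<close>,
  \<open>\<parallel>S\<^sub>t f\<parallel> \<le> \<Lambda>\<^sup>M (\<parallel>S\<^sub>t f\<parallel>\<^sub>\<Omega> + c r\<^sup>-\<^sup>M exp (C r\<^sup>2 / t) \<parallel>f\<parallel>)\<close>.

  With \<open>r\<close> a fixed large multiple of \<open>\<Lambda>\<^sup>2\<close>, apply this between the times \<open>T/2\<^sup>n\<^sup>+\<^sup>1\<close> and \<open>t \<in> [3/4 T/2\<^sup>n, T/2\<^sup>n]\<close> with
  \<open>M\<close> proportional to \<open>2\<^sup>n\<close> and average over \<open>t\<close>. The resulting inequalities telescope and bound \<open>\<parallel>S\<^sub>T f\<parallel>\<close> by the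
  \<open>L\<^sup>1\<close> norm of \<open>t \<mapsto> \<parallel>S\<^sub>t f\<parallel>\<^sub>\<Omega>\<close> on \<open>[0, T]\<close>, which is dominated by the \<open>L\<^sup>r\<close> norms.
\<close>

section \<open>Extrapolation from a set of positive measure\<close>

text \<open>Greedy choice from the left: take \<open>s0\<close> in \<open>E\<close> close to its
  infimum and discard the part of \<open>E\<close> below \<open>s0 + \<eta>\<close>. This costs less
  than \<open>\<eta>\<close> plus the surplus \<open>\<epsilon>\<close>, so more than
  \<open>n * \<eta>\<close> of measure is left for the other points.\<close>

lemma separated_points:
  fixes E :: "real set"
  assumes "E \<in> sets lborel" "E \<subseteq> {0..1}" "real n * \<eta> < measure lborel E" "0 \<le> \<eta>"
  shows "\<exists>s. (\<forall>i<n. s i \<in> E) \<and> (\<forall>j<n. \<forall>i<j. (real j - real i) * \<eta> \<le> s j - s i)"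
  using assms
proof (induction n arbitrary: E)
  case 0
  then show ?case by auto
next
  case (Suc n)
  define a where "a = Inf E"
  define \<epsilon> where "\<epsilon> = measure lborel E - real (Suc n) * \<eta>"
  have bdd: "bdd_below E" using Suc.prems(2) by (meson bdd_below_Icc bdd_below_mono)
  have "0 \<le> real (Suc n) * \<eta>" using Suc.prems(4) by simp
  then have "E \<noteq> {}" using Suc.prems(3) by auto
  moreover have "0 < \<epsilon>" using Suc.prems(3) by (simp add: \<epsilon>_def)
  ultimately obtain s0 where s0: "s0 \<in> E" "s0 < a + \<epsilon>"
    using cInf_lessD[of E "a + \<epsilon>"] by (auto simp: a_def)
  have "a \<le> s0" using bdd s0 by (auto simp: a_def intro: cInf_lower)
  define E' where "E' = E \<inter> {s0 + \<eta>..}"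
  have E'[measurable]: "E' \<in> sets lborel" using Suc.prems(1) by (auto simp: E'_def)
  have fin: "E' \<in> fmeasurable lborel" "{a..s0 + \<eta>} \<in> fmeasurable lborel"
    using E' bounded_subset[OF bounded_closed_interval, of E' 0 1] Suc.prems(2)
    by (auto intro!: fmeasurableI emeasure_bounded_finite simp: E'_def)
  have "E \<subseteq> E' \<union> {a..s0 + \<eta>}"
    using bdd by (auto simp: E'_def a_def intro: cInf_lower)
  then have "measure lborel E \<le> measure lborel (E' \<union> {a..s0 + \<eta>})"
    using fin Suc.prems(1) by (intro measure_mono_fmeasurable) auto
  also have "\<dots> \<le> measure lborel E' + measure lborel {a..s0 + \<eta>}"
    using fin by (intro measure_Un_le) auto
  also have "measure lborel {a..s0 + \<eta>} = s0 + \<eta> - a"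
    using \<open>a \<le> s0\<close> Suc.prems(4) by simp
  finally have gt: "real n * \<eta> < measure lborel E'"
    using s0(2) by (simp add: \<epsilon>_def algebra_simps)
  have sub: "E' \<subseteq> {0..1}" using Suc.prems(2) by (auto simp: E'_def)
  obtain s where s: "\<And>i. i < n \<Longrightarrow> s i \<in> E'"
      "\<And>i j. j < n \<Longrightarrow> i < j \<Longrightarrow> (real j - real i) * \<eta> \<le> s j - s i"
    using Suc.IH[OF E' sub gt Suc.prems(4)] by blast
  show ?case
  proof (intro exI[of _ "case_nat s0 s"] conjI allI impI)
    fix i assume "i < Suc n"
    then show "(case i of 0 \<Rightarrow> s0 | Suc x \<Rightarrow> s x) \<in> E"
      using s0 s(1) by (auto simp: E'_def split: nat.split)
  next
    fix j i assume ij: "j < Suc n" "i < j"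
    then obtain j' where j: "j = Suc j'" "j' < n" by (cases j) auto
    show "(real j - real i) * \<eta> \<le> (case j of 0 \<Rightarrow> s0 | Suc x \<Rightarrow> s x) - (case i of 0 \<Rightarrow> s0 | Suc x \<Rightarrow> s x)"
    proof (cases i)
      case 0
      have "s0 + \<eta> \<le> s 0" using s(1)[of 0] j by (auto simp: E'_def)
      moreover have "real j' * \<eta> \<le> s j' - s 0" using s(2)[of j' 0] j by (cases "j' = 0") auto
      ultimately show ?thesis using 0 j by (simp add: algebra_simps)
    next
      case (Suc i')
      then show ?thesis using s(2)[of j' i'] ij j by simp
    qed
  qed
qed

text \<open>The weights are the values at 0 of the Lagrange basis polynomials for the nodes
  \<open>s i\<close>. The interpolant \<open>Q\<close> agrees with \<open>P\<close> at
  \<open>N\<close> nodes and both have degree below \<open>N\<close>, so they coincide.\<close>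

lemma lagrange_at_0:
  fixes s :: "nat \<Rightarrow> real"
  assumes inj: "inj_on s {..<N}" and deg: "degree P < N"
  shows "(\<Sum>i<N. (\<Prod>j\<in>{..<N} - {i}. s j / (s j - s i)) * poly P (s i)) = poly P 0"
proof -
  define l where "l i = (\<Prod>j\<in>{..<N} - {i}. smult (1 / (s j - s i)) [:s j, -1:])" for i
  define Q where "Q = (\<Sum>i<N. smult (poly P (s i)) (l i))"
  have poly_l: "poly (l i) x = (\<Prod>j\<in>{..<N} - {i}. (s j - x) / (s j - s i))" for i x
    by (simp add: l_def poly_prod diff_divide_distrib)
  have l_self: "poly (l i) (s i) = 1" if "i < N" for i
    unfolding poly_l using inj that by (intro prod.neutral) (auto dest: inj_onD)
  have l_other: "poly (l i) (s k) = 0" if "k < N" "k \<noteq> i" for i k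
    unfolding poly_l using that by (intro prod_zero) auto
  have "degree (l i) < N" if "i < N" for i
  proof -
    have "degree (l i) \<le> (\<Sum>j\<in>{..<N} - {i}. degree (smult (1 / (s j - s i)) [:s j, -1:]))"
      unfolding l_def using degree_prod_sum_le[of "{..<N} - {i}" "\<lambda>j. smult (1 / (s j - s i)) [:s j, -1:]"]
      by (simp only: o_def finite_Diff finite_lessThan)
    also have "\<dots> \<le> (\<Sum>j\<in>{..<N} - {i}. 1)"
      by (intro sum_mono order.trans[OF degree_smult_le]) auto
    also have "\<dots> < N" using that by simp
    finally show ?thesis .
  qed
  then have degQ: "degree Q < N"
    unfolding Q_def using deg
    by (intro degree_sum_less) (auto intro: le_less_trans[OF degree_smult_le])
  have Q: "poly Q (s k) = poly P (s k)" if "k < N" for k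
  proof -
    have "poly Q (s k) = (\<Sum>i<N. if i = k then poly P (s k) else 0)"
      unfolding Q_def poly_sum poly_smult using that by (intro sum.cong) (auto simp: l_self l_other)
    then show ?thesis using that by simp
  qed
  have "Q = P"
  proof (rule ccontr)
    assume "Q \<noteq> P"
    then have nz: "Q - P \<noteq> 0" by simp
    have "N = card (s ` {..<N})" using inj by (simp add: card_image)
    also have "\<dots> \<le> card {x. poly (Q - P) x = 0}"
      using nz Q by (intro card_mono poly_roots_finite) auto
    also have "\<dots> \<le> degree (Q - P)" using nz by (rule card_poly_roots_bound)
    also have "\<dots> < N" using degQ deg by (simp add: degree_diff_less)
    finally show False by simp
  qed
  then have "poly P 0 = (\<Sum>i<N. poly P (s i) * poly (l i) 0)"
    by (metis (no_types, lifting) Q_def poly_sum poly_smult sum.cong)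
  then show ?thesis by (simp add: poly_l mult.commute)
qed

text \<open>These products are the denominators of the Lagrange weights for integer nodes; the nodes
  to the left of \<open>i\<close> contribute \<open>fact i\<close>, those to the right
  \<open>fact (n - i)\<close>.\<close>

lemma prod_dist_nat:
  assumes "i \<le> n"
  shows "(\<Prod>j\<in>{..n} - {i}. \<bar>real j - real i\<bar>) = fact i * fact (n - i)"
proof -
  let ?f = "\<lambda>j. \<bar>real j - real i\<bar>"
  have "{..n} - {i} = {..<i} \<union> {i<..n}"
    unfolding set_eq_iff Un_iff Diff_iff lessThan_iff atMost_iff greaterThanAtMost_iff singleton_iff
    using assms by (intro allI) linarith
  moreover have "{..<i} \<inter> {i<..n} = {}" by auto
  ultimately have "prod ?f ({..n} - {i}) = prod ?f {..<i} * prod ?f {i<..n}"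
    by (metis finite_greaterThanAtMost finite_lessThan prod.union_disjoint)
  also have "prod ?f {..<i} = (\<Prod>j<i. real (i - j))" by (intro prod.cong) auto
  also have "\<dots> = fact i" by (simp add: fact_prod_rev atLeast0LessThan)
  also have "prod ?f {i<..n} = (\<Prod>k\<in>{1..n - i}. real k)"
    by (rule prod.reindex_bij_witness[of _ "\<lambda>k. k + i" "\<lambda>j. j - i"]) auto
  also have "\<dots> = fact (n - i)" by (simp add: fact_prod)
  finally show ?thesis .
qed

text \<open>A single term of the exponential series. It controls \<open>N ^ n / fact n\<close> in
  the Lagrange weights and produces the gain \<open>1 / r ^ M\<close> in the Taylor
  remainder.\<close>

lemma power_div_fact_le_exp:
  assumes "0 \<le> (x::real)"
  shows "x ^ n / fact n \<le> exp x"
proof -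
  have "(\<Sum>k\<in>{n}. x ^ k /\<^sub>R fact k) \<le> (\<Sum>k. x ^ k /\<^sub>R fact k)"
    using assms by (intro sum_le_suminf summable_exp_generic) auto
  then show ?thesis by (simp add: exp_def divide_inverse mult.commute)
qed

text \<open>The numerators are at most 1, and the nodes are at least as far apart as integers scaled
  by \<open>\<delta> / Suc n\<close>. Each weight is thus at most a multiple of a binomial
  coefficient; the coefficients sum to \<open>2 ^ n\<close>, and the remaining
  \<open>N ^ n / fact n\<close> is below \<open>exp N\<close>.\<close>

lemma lagrange_weights_bound:
  fixes s :: "nat \<Rightarrow> real"
  assumes s: "\<And>i. i < Suc n \<Longrightarrow> s i \<in> {0..1}"
    and sep: "\<And>i j. j < Suc n \<Longrightarrow> i < j \<Longrightarrow> (real j - real i) * (\<delta> / Suc n) \<le> s j - s i"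
    and \<delta>: "0 < \<delta>" "\<delta> \<le> 1"
  shows "(\<Sum>i<Suc n. \<bar>\<Prod>j\<in>{..<Suc n} - {i}. s j / (s j - s i)\<bar>) \<le> (2 * exp 1 / \<delta>) ^ Suc n"
proof -
  define N where "N = real (Suc n)"
  have N: "N > 0" by (simp add: N_def)
  have dist: "\<bar>real j - real i\<bar> * (\<delta> / N) \<le> \<bar>s j - s i\<bar>" if "i < Suc n" "j < Suc n" for i j
    using sep[of j i] sep[of i j] that by (cases i j rule: linorder_cases) (auto simp: N_def)
  have "\<bar>\<Prod>j\<in>{..<Suc n} - {i}. s j / (s j - s i)\<bar> \<le> (N / \<delta>) ^ n / fact n * real (n choose i)"
    if i: "i \<le> n" for i
  proof -
    have "\<bar>\<Prod>j\<in>{..<Suc n} - {i}. s j / (s j - s i)\<bar> = (\<Prod>j\<in>{..<Suc n} - {i}. \<bar>s j\<bar> / \<bar>s j - s i\<bar>)"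
      by (simp add: abs_prod)
    also have "\<dots> \<le> (\<Prod>j\<in>{..<Suc n} - {i}. 1 / (\<bar>real j - real i\<bar> * (\<delta> / N)))"
    proof (intro prod_mono conjI frac_le)
      fix j assume "j \<in> {..<Suc n} - {i}"
      then show "\<bar>s j\<bar> \<le> 1" "\<bar>real j - real i\<bar> * (\<delta> / N) \<le> \<bar>s j - s i\<bar>"
        "0 < \<bar>real j - real i\<bar> * (\<delta> / N)"
        using s[of j] dist[of i j] i \<delta> N by auto
    qed auto
    also have "\<dots> = (\<Prod>j\<in>{..n} - {i}. (N / \<delta>) * (1 / \<bar>real j - real i\<bar>))"
      by (intro prod.cong) auto
    also have "\<dots> = (N / \<delta>) ^ n * (1 / (\<Prod>j\<in>{..n} - {i}. \<bar>real j - real i\<bar>))"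
      using i by (simp add: prod.distrib prod_dividef power_divide)
    also have "\<dots> = (N / \<delta>) ^ n / fact n * real (n choose i)"
      using i by (simp add: prod_dist_nat binomial_fact)
    finally show ?thesis .
  qed
  then have "(\<Sum>i<Suc n. \<bar>\<Prod>j\<in>{..<Suc n} - {i}. s j / (s j - s i)\<bar>)
      \<le> (\<Sum>i<Suc n. (N / \<delta>) ^ n / fact n * real (n choose i))"
    by (intro sum_mono) auto
  also have "\<dots> = (N / \<delta>) ^ n / fact n * real (\<Sum>i\<le>n. n choose i)"
    by (simp only: sum_distrib_left[symmetric] of_nat_sum lessThan_Suc_atMost)
  also have "\<dots> = (2 / \<delta>) ^ n * (N ^ n / fact n)"
    by (simp only: choose_row_sum) (simp add: power_divide)
  \<comment> \<open>Raising the exponent to \<open>Suc n\<close> is possible because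
    \<open>\<delta> \<le> 1\<close> makes the base at least 1.\<close>
  also have "\<dots> \<le> (2 / \<delta>) ^ Suc n * exp N"
    using \<delta> N power_div_fact_le_exp[of N n] by (intro mult_mono power_increasing) auto
  also have "exp N = exp 1 ^ Suc n" unfolding N_def by (metis exp_of_nat_mult mult.right_neutral)
  also have "(2 / \<delta>) ^ Suc n * exp 1 ^ Suc n = (2 * exp 1 / \<delta>) ^ Suc n"
    unfolding power_mult_distrib[symmetric] by simp
  finally show ?thesis .
qed

text \<open>The parameter \<open>r\<close> trades growth in \<open>q\<close> for decay in
  \<open>M\<close>: in the Lagrange form of the remainder, \<open>q ^ M / fact M\<close> is
  rewritten as \<open>(r * q) ^ M / fact M / r ^ M\<close>, and the first quotient is at most
  \<open>exp (r * q)\<close>.\<close>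

lemma exp_taylor_remainder:
  fixes x :: real
  assumes "\<bar>x\<bar> \<le> q" "1 \<le> r"
  shows "\<bar>exp x - (\<Sum>m<M. x ^ m / fact m)\<bar> \<le> exp (2 * r * q) / r ^ M"
proof -
  have q: "0 \<le> q" using assms(1) by linarith
  obtain t where t: "\<bar>t\<bar> \<le> \<bar>x\<bar>" "exp x = (\<Sum>m<M. x ^ m / fact m) + exp t / fact M * x ^ M"
    using Maclaurin_exp_le by blast
  have "\<bar>exp x - (\<Sum>m<M. x ^ m / fact m)\<bar> = exp t * (\<bar>x\<bar> ^ M / fact M)"
    using t(2) by (simp add: abs_mult power_abs)
  also have "\<dots> \<le> exp q * (q ^ M / fact M)"
    using t(1) assms by (intro mult_mono divide_right_mono power_mono) auto
  also have "q ^ M / fact M = ((r * q) ^ M / fact M) / r ^ M"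
    using assms by (simp add: power_mult_distrib)
  also have "exp q * \<dots> \<le> exp q * (exp (r * q) / r ^ M)"
    using assms q by (intro mult_left_mono divide_right_mono power_div_fact_le_exp) auto
  also have "\<dots> = exp (q + r * q) / r ^ M" by (simp add: exp_add)
  also have "\<dots> \<le> exp (2 * r * q) / r ^ M"
    using assms mult_right_mono[OF assms(2) q] by (intro divide_right_mono) (auto simp: algebra_simps)
  finally show ?thesis .
qed

text \<open>
  The quadrature rule is exact on the \<open>M\<close>-th Taylor polynomial of \<open>exp\<close> composed with the quadratic,
  so only the Taylor remainder contributes.
\<close>

lemma exp_quadratic_quadrature:
  fixes w s :: "nat \<Rightarrow> real"
  assumes exact: "\<forall>P. degree P < 2 * M \<longrightarrow> (\<Sum>i<N. w i * poly P (s i)) = poly P 0"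
    and s: "\<forall>i<N. s i \<in> {0..1}" and M: "1 \<le> M" and r: "1 \<le> r"
  shows "\<bar>1 - (\<Sum>i<N. w i * exp (- (b * s i + a * (s i)\<^sup>2)))\<bar>
    \<le> (\<Sum>i<N. \<bar>w i\<bar>) * (exp (2 * r * (\<bar>a\<bar> + \<bar>b\<bar>)) / r ^ M)"
proof -
  define p where "p = [:0, -b, -a:]"
  define P where "P = (\<Sum>m<M. smult (1 / fact m) (p ^ m))"
  define B where "B = exp (2 * r * (\<bar>a\<bar> + \<bar>b\<bar>)) / r ^ M"
  have p: "poly p x = - (b * x + a * x\<^sup>2)" for x
    by (simp add: p_def power2_eq_square algebra_simps)
  have P: "poly P x = (\<Sum>m<M. poly p x ^ m / fact m)" for x
    by (simp add: P_def poly_sum)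
  have "degree p \<le> 2" by (simp add: p_def)
  \<comment> \<open>The exponent is quadratic, so the Taylor polynomial with \<open>M\<close> terms
    has degree below \<open>2 * M\<close>; this dictates the degree of exactness of the
    rule.\<close>
  then have "degree (smult (1 / fact m) (p ^ m)) < 2 * M" if "m < M" for m
    using degree_power_le[of p m] that mult_le_mono1[of "degree p" 2 m]
    by (intro le_less_trans[OF degree_smult_le]) linarith
  then have "degree P < 2 * M" unfolding P_def using M by (intro degree_sum_less) auto
  then have "(\<Sum>i<N. w i * poly P (s i)) = poly P 0" using exact by blast
  also have "\<dots> = 1" using M by (simp add: P p power_0_left sum.delta if_distrib[of "\<lambda>x. x / _"] cong: if_cong)
  finally have "1 - (\<Sum>i<N. w i * exp (poly p (s i))) = - (\<Sum>i<N. w i * (exp (poly p (s i)) - poly P (s i)))"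
    by (simp add: right_diff_distrib sum_subtractf)
  also have "\<bar>\<dots>\<bar> \<le> (\<Sum>i<N. \<bar>w i\<bar> * \<bar>exp (poly p (s i)) - poly P (s i)\<bar>)"
    by (simp add: abs_mult[symmetric] sum_abs)
  also have "\<dots> \<le> (\<Sum>i<N. \<bar>w i\<bar> * B)"
  proof (intro sum_mono mult_left_mono)
    fix i assume "i \<in> {..<N}"
    then have s01: "0 \<le> s i" "s i \<le> 1" using s by auto
    have "\<bar>poly p (s i)\<bar> \<le> \<bar>b * s i\<bar> + \<bar>a * (s i)\<^sup>2\<bar>" unfolding p by simp
    also have "\<dots> \<le> \<bar>b\<bar> * 1 + \<bar>a\<bar> * 1"
      unfolding abs_mult using s01 by (intro add_mono mult_left_mono) (auto simp: power_le_one)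
    finally have "\<bar>poly p (s i)\<bar> \<le> \<bar>a\<bar> + \<bar>b\<bar>" by simp
    then show "\<bar>exp (poly p (s i)) - poly P (s i)\<bar> \<le> B"
      unfolding P B_def using r by (rule exp_taylor_remainder)
  qed auto
  finally show ?thesis by (simp only: p B_def sum_distrib_right)
qed

section \<open>The Gauss--Weierstrass semigroup\<close>

lemma heat_kernel_nonneg: "0 < t \<Longrightarrow> 0 \<le> heat_kernel t x"
  by (simp add: heat_kernel_def)

lemma heat_kernel_minus: "heat_kernel t (- x) = heat_kernel t x"
  by (simp add: heat_kernel_def)

text \<open>Time is allowed to vary as well, because the observed norm must later be measurable in
  \<open>t\<close>.\<close>

lemma borel_measurable_heat_kernel [measurable (raw)]:
  assumes [measurable]: "t \<in> borel_measurable M" "g \<in> borel_measurable M"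
  shows "(\<lambda>x. heat_kernel (t x) (g x :: real ^ 'd)) \<in> borel_measurable M"
  unfolding heat_kernel_def by measurable

lemma borel_measurable_apply_bcontfun [measurable]:
  fixes f :: "'a::euclidean_space \<Rightarrow>\<^sub>C 'b::euclidean_space"
  shows "apply_bcontfun f \<in> borel_measurable borel"
  by (intro borel_measurable_continuous_onI) auto

text \<open>The kernel factors over the coordinates into centred normal densities of variance
  \<open>2 * t\<close>, each with integral 1.\<close>

lemma integral_heat_kernel:
  assumes "t > 0"
  shows "(\<integral>x. heat_kernel t (x :: real ^ 'd) \<partial>lborel) = 1"
proof -
  let ?g = "\<lambda>x. normal_density 0 (sqrt (2 * t)) x"
  interpret product_sigma_finite "\<lambda>_::real^'d. lborel :: real measure" ..
  have eq: "(\<Prod>b\<in>Basis. ?g (x b)) = heat_kernel t (\<Sum>b\<in>(Basis :: (real^'d) set). x b *\<^sub>R b)" for x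
  proof -
    have "?g y = (4 * pi * t) powr (- (1 / 2)) * exp (- y\<^sup>2 / (4 * t))" for y
      using assms by (simp add: normal_density_def powr_minus_divide powr_half_sqrt)
    then have "(\<Prod>b\<in>Basis. ?g (x b)) =
        ((4 * pi * t) powr (- (1 / 2))) ^ CARD('d) * exp (\<Sum>b\<in>(Basis :: (real^'d) set). - (x b)\<^sup>2 / (4 * t))"
      by (simp add: prod.distrib exp_sum)
    moreover have "((4 * pi * t) powr (- (1 / 2))) ^ CARD('d) = (4 * pi * t) powr (- (real CARD('d) / 2))"
      using assms by (simp add: powr_power)
    moreover have "(norm (\<Sum>b\<in>(Basis :: (real^'d) set). x b *\<^sub>R b))\<^sup>2 = (\<Sum>b\<in>Basis. (x b)\<^sup>2)"
      by (subst power2_norm_eq_inner, subst euclidean_inner) (simp add: power2_eq_square)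
    ultimately show ?thesis
      by (simp add: heat_kernel_def sum_negf sum_divide_distrib)
  qed
  have "(\<integral>x. heat_kernel t (x :: real ^ 'd) \<partial>lborel)
      = (\<integral>x. heat_kernel t (\<Sum>b\<in>(Basis :: (real^'d) set). x b *\<^sub>R b) \<partial>(\<Pi>\<^sub>M b\<in>Basis. lborel))"
    by (subst lborel_eq, subst integral_distr) auto
  also have "\<dots> = (\<Prod>b\<in>(Basis :: (real^'d) set). \<integral>x. ?g x \<partial>lborel)"
    unfolding eq[symmetric] using assms
    by (intro product_integral_prod) (auto intro: integrable_normal_density)
  also have "\<dots> = 1" using assms by (intro prod.neutral) (auto intro: integral_normal_density)
  finally show ?thesis .
qed

lemma integrable_heat_kernel_shift:
  fixes x :: "real ^ 'd"
  assumes "0 < t"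
  shows "integrable lborel (\<lambda>y. heat_kernel t (x - y))" "integrable lborel (\<lambda>y. heat_kernel t (y - x))"
proof -
  show *: "integrable lborel (\<lambda>y. heat_kernel t (y - x))"
    using integrable_heat_kernel[OF assms]
    by (subst (asm) lborel_distr_plus[symmetric, of "- x"], subst (asm) integrable_distr_eq) auto
  then show "integrable lborel (\<lambda>y. heat_kernel t (x - y))"
    using heat_kernel_minus[of t "_ - x"] by simp
qed

lemma integral_heat_kernel_shift:
  fixes x :: "real ^ 'd"
  assumes "0 < t"
  shows "(\<integral>y. heat_kernel t (y - x) \<partial>lborel) = 1" "(\<integral>y. heat_kernel t (x - y) \<partial>lborel) = 1"
proof -
  show *: "(\<integral>y. heat_kernel t (y - x) \<partial>lborel) = 1"
    using integral_heat_kernel[OF assms, where 'd='d]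
    by (subst (asm) lborel_distr_plus[symmetric, of "- x"], subst (asm) integral_distr) auto
  then show "(\<integral>y. heat_kernel t (x - y) \<partial>lborel) = 1"
    using heat_kernel_minus[of t "_ - x"] by simp
qed

text \<open>Completing the square in \<open>y\<close>.\<close>

lemma heat_kernel_mult:
  fixes x y z :: "real ^ 'd"
  assumes "0 < s" "0 < t"
  shows "heat_kernel t (x - y) * heat_kernel s (y - z) =
    heat_kernel (s + t) (x - z) * heat_kernel (s * t / (s + t)) (y - (s *\<^sub>R x + t *\<^sub>R z) /\<^sub>R (s + t))"
proof -
  define a b where "a = x - y" "b = y - z"
  have xz: "x - z = a + b" by (simp add: a_b_def)
  have "(s + t) *\<^sub>R (y - (s *\<^sub>R x + t *\<^sub>R z) /\<^sub>R (s + t)) = (s + t) *\<^sub>R y - (s *\<^sub>R x + t *\<^sub>R z)"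
    using assms by (simp add: scaleR_diff_right)
  also have "\<dots> = t *\<^sub>R b - s *\<^sub>R a" by (simp add: a_b_def algebra_simps)
  finally have "y - (s *\<^sub>R x + t *\<^sub>R z) /\<^sub>R (s + t) = (t *\<^sub>R b - s *\<^sub>R a) /\<^sub>R (s + t)"
    using assms by (metis add_pos_pos less_irrefl scaleR_left.zero scaleR_one scaleR_scaleR left_inverse)
  then have "(norm (y - (s *\<^sub>R x + t *\<^sub>R z) /\<^sub>R (s + t)))\<^sup>2 = (norm (t *\<^sub>R b - s *\<^sub>R a))\<^sup>2 / (s + t)\<^sup>2"
    using assms by (simp add: power_mult_distrib divide_inverse power_inverse)
  also have "(norm (t *\<^sub>R b - s *\<^sub>R a))\<^sup>2 = t\<^sup>2 * (norm b)\<^sup>2 + s\<^sup>2 * (norm a)\<^sup>2 - 2 * s * t * (a \<bullet> b)"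
    unfolding power2_norm_eq_inner
    by (simp add: inner_diff_left inner_diff_right inner_commute power2_eq_square)
  finally have y: "(norm (y - (s *\<^sub>R x + t *\<^sub>R z) /\<^sub>R (s + t)))\<^sup>2 =
    (t\<^sup>2 * (norm b)\<^sup>2 + s\<^sup>2 * (norm a)\<^sup>2 - 2 * s * t * (a \<bullet> b)) / (s + t)\<^sup>2" .
  have ab: "(norm (a + b))\<^sup>2 = (norm a)\<^sup>2 + (norm b)\<^sup>2 + 2 * (a \<bullet> b)"
    unfolding power2_norm_eq_inner by (simp add: inner_add_left inner_add_right inner_commute)
  \<comment> \<open>The identity of the exponents, with \<open>A\<close>, \<open>B\<close>,
    \<open>c\<close> standing for the squared norms of \<open>a\<close> and \<open>b\<close> and for
    their inner product.\<close>
  have alg: "- A / (4 * t) + - B / (4 * s) =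
     - (A + B + 2 * c) / (4 * (s + t)) + - ((t\<^sup>2 * B + s\<^sup>2 * A - 2 * s * t * c) / (s + t)\<^sup>2) / (4 * (s * t / (s + t)))"
    for A B c :: real
  proof -
    have "s + t \<noteq> 0" "s \<noteq> 0" "t \<noteq> 0" using assms by auto
    then show ?thesis by (simp add: divide_simps) algebra
  qed
  \<comment> \<open>This makes the normalising factors of the two products of kernels equal.\<close>
  have "(4 * pi * t) * (4 * pi * s) = (4 * pi * (s + t)) * (4 * pi * (s * t / (s + t)))"
    using assms by (simp add: field_simps)
  then have "(4 * pi * t) powr p * (4 * pi * s) powr p =
      (4 * pi * (s + t)) powr p * (4 * pi * (s * t / (s + t))) powr p" for p
    using assms by (simp only: powr_mult[symmetric] zero_le_mult_iff divide_nonneg_pos add_pos_pos)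
  moreover have "exp (- (norm a)\<^sup>2 / (4 * t)) * exp (- (norm b)\<^sup>2 / (4 * s)) =
     exp (- (norm (a + b))\<^sup>2 / (4 * (s + t))) *
     exp (- (norm (y - (s *\<^sub>R x + t *\<^sub>R z) /\<^sub>R (s + t)))\<^sup>2 / (4 * (s * t / (s + t))))"
    unfolding exp_add[symmetric] y ab by (rule arg_cong[of _ _ exp], rule alg)
  moreover have "(a1 * e1) * (a2 * e2) = (b1 * c1) * (b2 * c2)"
    if "a1 * a2 = b1 * b2" "e1 * e2 = c1 * c2" for a1 a2 b1 b2 c1 c2 e1 e2 :: real
    using arg_cong2[OF that, of "(*)"] by (simp add: mult_ac)
  ultimately show ?thesis
    unfolding heat_kernel_def xz a_b_def[symmetric] by blast
qed

text \<open>The kernel is nonnegative with integral 1. Contractivity also makes the norm decrease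
  along the semigroup.\<close>

lemma norm_gauss_weierstrass_le:
  fixes f :: "(real ^ 'd) \<Rightarrow>\<^sub>C 'b::euclidean_space"
  shows "norm (gauss_weierstrass t f) \<le> norm f"
proof (cases "0 < t")
  case True
  show ?thesis
  proof (rule norm_bound)
    fix x
    have "norm (conv (heat_kernel t) f x) \<le> (\<integral>y. heat_kernel t (x - y) * norm f \<partial>lborel)"
      unfolding conv_def
    proof (rule Bochner_Integration.integral_norm_bound_integral)
      show int: "integrable lborel (\<lambda>y. heat_kernel t (x - y) * norm f)"
        using True by (intro integrable_mult_left integrable_heat_kernel_shift)
      show le: "norm (heat_kernel t (x - y) *\<^sub>R f y) \<le> heat_kernel t (x - y) * norm f" for y
        using True by (auto simp: heat_kernel_nonneg intro!: mult_left_mono norm_bounded)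
      show "integrable lborel (\<lambda>y. heat_kernel t (x - y) *\<^sub>R apply_bcontfun f y)"
        by (rule Bochner_Integration.integrable_bound[OF int])
          (use True in \<open>auto simp: heat_kernel_nonneg intro!: mult_left_mono norm_bounded\<close>)
    qed
    also have "\<dots> = norm f" using True by (simp add: integral_heat_kernel_shift)
    finally show "norm (gauss_weierstrass t f x) \<le> norm f"
      using True by (simp add: gauss_weierstrass_apply)
  qed
qed (simp add: gauss_weierstrass_def)

lemma integrable_heat_kernel_bcontfun:
  fixes f :: "(real ^ 'd) \<Rightarrow>\<^sub>C 'b::euclidean_space"
  assumes "0 < t"
  shows "integrable lborel (\<lambda>y. heat_kernel t (x - y) *\<^sub>R f y)"
proof (rule Bochner_Integration.integrable_bound)
  show "integrable lborel (\<lambda>y. heat_kernel t (x - y) * norm f)"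
    using assms by (intro integrable_mult_left integrable_heat_kernel_shift)
qed (use assms in \<open>auto simp: heat_kernel_nonneg intro!: mult_left_mono norm_bounded\<close>)

text \<open>After completing the square, the intermediate variable \<open>y\<close> occurs in only
  one Gaussian factor, which integrates to 1; Fubini allows integrating over \<open>y\<close>
  first.\<close>

lemma gauss_weierstrass_semigroup:
  fixes f :: "(real ^ 'd) \<Rightarrow>\<^sub>C 'b::euclidean_space"
  assumes "0 < s" "0 < t"
  shows "gauss_weierstrass t (gauss_weierstrass s f) = gauss_weierstrass (s + t) f"
proof (rule bcontfun_eqI)
  fix x :: "real ^ 'd"
  define \<tau> where "\<tau> = s * t / (s + t)"
  have \<tau>: "0 < \<tau>" using assms by (simp add: \<tau>_def)
  let ?w = "\<lambda>z. (s *\<^sub>R x + t *\<^sub>R z) /\<^sub>R (s + t)"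
  let ?K = "\<lambda>z y. (heat_kernel (s + t) (x - z) * heat_kernel \<tau> (y - ?w z)) *\<^sub>R apply_bcontfun f z"
  have K: "?K z y = heat_kernel t (x - y) *\<^sub>R heat_kernel s (y - z) *\<^sub>R f z" for z y
    by (simp add: heat_kernel_mult[OF assms] \<tau>_def)
  have int: "integrable (lborel \<Otimes>\<^sub>M lborel) (\<lambda>(z, y). ?K z y)"
  proof (rule lborel_pair.Fubini_integrable)
    show "(\<lambda>(z, y). ?K z y) \<in> borel_measurable (lborel \<Otimes>\<^sub>M lborel)"
      by measurable
    have "(\<lambda>z. \<integral>y. norm (?K z y) \<partial>lborel) = (\<lambda>z. norm (heat_kernel (s + t) (x - z) *\<^sub>R f z))"
      using assms \<tau> by (simp add: heat_kernel_nonneg abs_mult integral_heat_kernel_shift mult_ac)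
    then show "integrable lborel (\<lambda>z. \<integral>y. norm (case (z, y) of (z, y) \<Rightarrow> ?K z y) \<partial>lborel)"
      unfolding prod.case using assms
      by (simp only:) (intro integrable_norm integrable_heat_kernel_bcontfun, simp)
    show "AE z in lborel. integrable lborel (\<lambda>y. case (z, y) of (z, y) \<Rightarrow> ?K z y)"
      unfolding prod.case using \<tau>
      by (intro AE_I2 integrable_scaleR_left integrable_mult_right integrable_heat_kernel_shift) auto
  qed
  have "conv (heat_kernel t) (conv (heat_kernel s) f) x = (\<integral>y. \<integral>z. ?K z y \<partial>lborel \<partial>lborel)"
    unfolding K conv_def by (simp del: scaleR_scaleR)
  also have "\<dots> = (\<integral>z. \<integral>y. ?K z y \<partial>lborel \<partial>lborel)"
    using int by (rule lborel_pair.Fubini_integral)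
  also have "\<dots> = conv (heat_kernel (s + t)) f x"
    unfolding conv_def using \<tau>
    by (intro Bochner_Integration.integral_cong refl, subst integral_scaleR_left)
      (simp_all add: integral_heat_kernel_shift integrable_heat_kernel_shift)
  finally show "gauss_weierstrass t (gauss_weierstrass s f) x = gauss_weierstrass (s + t) f x"
    using assms by (simp add: gauss_weierstrass_apply)
qed

section \<open>Interpolation inequality for thick sets\<close>

text \<open>\<open>N\<close> points at distance \<open>\<delta> / N\<close> fit into
  \<open>E\<close> because its measure exceeds \<open>\<delta>\<close>; the Lagrange weights at
  these points do the rest.\<close>

lemma quadrature_weights:
  fixes E :: "real set"
  assumes E: "E \<in> sets lborel" "E \<subseteq> {0..1}" "\<delta> < measure lborel E" and "0 < \<delta>" "1 \<le> N"
  shows "\<exists>w s. (\<forall>i<N. s i \<in> E) \<and> (\<forall>P. degree P < N \<longrightarrow> (\<Sum>i<N. w i * poly P (s i)) = poly P 0) \<and>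
    (\<Sum>i<N. \<bar>w i\<bar>) \<le> (2 * exp 1 / \<delta>) ^ N"
proof -
  obtain n where n: "N = Suc n" using \<open>1 \<le> N\<close> by (cases N) auto
  \<comment> \<open>This serves to obtain \<open>\<delta> \<le> 1\<close> for the bound on the
    weights.\<close>
  have "measure lborel E \<le> measure lborel {0..1::real}"
    using E by (intro measure_mono_fmeasurable) (auto intro: fmeasurableI)
  then have \<delta>: "0 < \<delta>" "\<delta> \<le> 1" using assms by auto
  obtain s where s: "\<And>i. i < N \<Longrightarrow> s i \<in> E"
      "\<And>i j. j < N \<Longrightarrow> i < j \<Longrightarrow> (real j - real i) * (\<delta> / N) \<le> s j - s i"
  proof -
    have "real N * (\<delta> / N) < measure lborel E" using E n by simp
    moreover have "0 \<le> \<delta> / N" using \<delta> by simp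
    ultimately show ?thesis using that separated_points[OF E(1,2), of N "\<delta> / N"] by auto
  qed
  have pos: "s i < s j" if "i < j" "j < N" for i j
  proof -
    have "0 < (real j - real i) * (\<delta> / N)" using that \<delta> by simp
    then show ?thesis using s(2)[of j i] that by linarith
  qed
  have s01: "s i \<in> {0..1}" if "i < N" for i using s(1)[OF that] E(2) by blast
  have inj: "inj_on s {..<N}"
  proof (rule inj_onI)
    fix i j assume "i \<in> {..<N}" "j \<in> {..<N}" "s i = s j"
    then show "i = j" using pos[of i j] pos[of j i] by (cases i j rule: linorder_cases) auto
  qed
  define w where "w i = (\<Prod>j\<in>{..<N} - {i}. s j / (s j - s i))" for i
  have "(\<Sum>i<N. \<bar>w i\<bar>) \<le> (2 * exp 1 / \<delta>) ^ N"
    using lagrange_weights_bound[of n s \<delta>] s01 s(2) \<delta> unfolding n w_def by blast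
  moreover have "\<forall>P. degree P < N \<longrightarrow> (\<Sum>i<N. w i * poly P (s i)) = poly P 0"
    unfolding w_def using lagrange_at_0[OF inj] by simp
  ultimately show ?thesis using s(1) by (intro exI[of _ w] exI[of _ s]) simp
qed

text \<open>Relative to its value at \<open>z\<close>, the kernel along the line is
  \<open>exp\<close> of a quadratic whose linear coefficient \<open>b\<close> grows with
  \<open>z\<close>. The resulting factor \<open>exp (2 * r * \<bar>b\<bar>)\<close> is absorbed by
  passing from time \<open>t\<close> to the wider Gaussian at time \<open>2 * t\<close>.\<close>

lemma heat_kernel_quadrature:
  fixes z v :: "real ^ 'd" and w s :: "nat \<Rightarrow> real"
  assumes exact: "\<forall>P. degree P < 2 * M \<longrightarrow> (\<Sum>i<N. w i * poly P (s i)) = poly P 0"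
    and s: "\<forall>i<N. s i \<in> {0..1}" and M: "1 \<le> M" and r: "1 \<le> r" and t: "0 < t"
  shows "\<bar>heat_kernel t z - (\<Sum>i<N. w i * heat_kernel t (z + s i *\<^sub>R v))\<bar> \<le>
    (\<Sum>i<N. \<bar>w i\<bar>) * (2 powr (real CARD('d) / 2) * exp (3 * r\<^sup>2 * (norm v)\<^sup>2 / t) / r ^ M) * heat_kernel (2 * t) z"
proof -
  define a where "a = (norm v)\<^sup>2 / (4 * t)"
  define b where "b = z \<bullet> v / (2 * t)"
  define W where "W = (\<Sum>i<N. \<bar>w i\<bar>)"
  have shift: "heat_kernel t (z + \<sigma> *\<^sub>R v) = heat_kernel t z * exp (- (b * \<sigma> + a * \<sigma>\<^sup>2))" for \<sigma>
  proof -
    have "(norm (z + \<sigma> *\<^sub>R v))\<^sup>2 = (norm z)\<^sup>2 + 2 * \<sigma> * (z \<bullet> v) + \<sigma>\<^sup>2 * (norm v)\<^sup>2"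
      unfolding power2_norm_eq_inner
      by (simp add: inner_add_left inner_add_right inner_commute power2_eq_square)
    then have "- (norm (z + \<sigma> *\<^sub>R v))\<^sup>2 / (4 * t) = - (norm z)\<^sup>2 / (4 * t) + - (b * \<sigma> + a * \<sigma>\<^sup>2)"
      using t by (simp add: a_def b_def field_simps)
    then show ?thesis by (simp only: heat_kernel_def exp_add mult.assoc)
  qed
  have "heat_kernel t z - (\<Sum>i<N. w i * heat_kernel t (z + s i *\<^sub>R v)) =
      heat_kernel t z * (1 - (\<Sum>i<N. w i * exp (- (b * s i + a * (s i)\<^sup>2))))"
    unfolding shift by (simp add: right_diff_distrib sum_distrib_left mult_ac)
  then have "\<bar>heat_kernel t z - (\<Sum>i<N. w i * heat_kernel t (z + s i *\<^sub>R v))\<bar> =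
      heat_kernel t z * \<bar>1 - (\<Sum>i<N. w i * exp (- (b * s i + a * (s i)\<^sup>2)))\<bar>"
    using t by (simp add: abs_mult heat_kernel_nonneg)
  also have "\<dots> \<le> heat_kernel t z * (W * (exp (2 * r * (\<bar>a\<bar> + \<bar>b\<bar>)) / r ^ M))"
    unfolding W_def using t
    by (intro mult_left_mono exp_quadratic_quadrature[OF exact s M r] heat_kernel_nonneg)
  also have "\<dots> = W / r ^ M * (heat_kernel t z * exp (2 * r * (\<bar>a\<bar> + \<bar>b\<bar>)))" by simp
  also have "\<dots> \<le> W / r ^ M * (2 powr (real CARD('d) / 2) * exp (3 * r\<^sup>2 * (norm v)\<^sup>2 / t) * heat_kernel (2 * t) z)"
  proof (rule mult_left_mono)
    have "\<bar>b\<bar> \<le> norm z * norm v / (2 * t)"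
      unfolding b_def abs_divide using t Cauchy_Schwarz_ineq2[of z v] by (simp add: divide_right_mono)
    then have "2 * r * (\<bar>a\<bar> + \<bar>b\<bar>) \<le> 2 * r * ((norm v)\<^sup>2 / (4 * t) + norm z * norm v / (2 * t))"
      using r t by (intro mult_left_mono) (auto simp: a_def)
    also have "\<dots> = (4 * r * (norm v)\<^sup>2 + 8 * r * norm z * norm v) / (8 * t)"
      using t by (simp add: field_simps)
    \<comment> \<open>The terms in \<open>norm v\<close> add up to at most
      \<open>20 * r\<^sup>2\<close>; rounding up to 24 leaves the coefficient 3 after division by
      8.\<close>
    also have "\<dots> \<le> (24 * r\<^sup>2 * (norm v)\<^sup>2 + (norm z)\<^sup>2) / (8 * t)"
    proof (rule divide_right_mono)
      \<comment> \<open>This square gives \<open>norm z\<close> squared the coefficient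
        \<open>1 / (8 * t)\<close>, exactly the difference between the exponents at times
        \<open>t\<close> and \<open>2 * t\<close>.\<close>
      have "0 \<le> (norm z - 4 * r * norm v)\<^sup>2" by simp
      then have "8 * r * norm z * norm v \<le> (norm z)\<^sup>2 + 16 * r\<^sup>2 * (norm v)\<^sup>2"
        by (simp add: power2_diff power_mult_distrib algebra_simps)
      moreover have "r * (norm v)\<^sup>2 \<le> r\<^sup>2 * (norm v)\<^sup>2"
        using r by (intro mult_right_mono) (auto simp: power2_eq_square)
      moreover have "0 \<le> r\<^sup>2 * (norm v)\<^sup>2" by simp
      ultimately show "4 * r * (norm v)\<^sup>2 + 8 * r * norm z * norm v \<le> 24 * r\<^sup>2 * (norm v)\<^sup>2 + (norm z)\<^sup>2"
        by linarith
    qed (use t in simp)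
    also have "\<dots> = 3 * r\<^sup>2 * (norm v)\<^sup>2 / t + (norm z)\<^sup>2 / (8 * t)"
      using t by (simp add: field_simps)
    finally have "2 * r * (\<bar>a\<bar> + \<bar>b\<bar>) \<le> 3 * r\<^sup>2 * (norm v)\<^sup>2 / t + (norm z)\<^sup>2 / (8 * t)" .
    moreover have "- (norm z)\<^sup>2 / (4 * t) + (norm z)\<^sup>2 / (8 * t) = - (norm z)\<^sup>2 / (4 * (2 * t))"
      using t by (simp add: field_simps)
    ultimately have "- (norm z)\<^sup>2 / (4 * t) + 2 * r * (\<bar>a\<bar> + \<bar>b\<bar>)
        \<le> 3 * r\<^sup>2 * (norm v)\<^sup>2 / t + - (norm z)\<^sup>2 / (4 * (2 * t))"
      by linarith
    then have "exp (- (norm z)\<^sup>2 / (4 * t)) * exp (2 * r * (\<bar>a\<bar> + \<bar>b\<bar>))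
        \<le> exp (3 * r\<^sup>2 * (norm v)\<^sup>2 / t) * exp (- (norm z)\<^sup>2 / (4 * (2 * t)))"
      unfolding exp_add[symmetric] by simp
    then have "(4 * pi * t) powr (- (real CARD('d) / 2)) * (exp (- (norm z)\<^sup>2 / (4 * t)) * exp (2 * r * (\<bar>a\<bar> + \<bar>b\<bar>)))
      \<le> (4 * pi * t) powr (- (real CARD('d) / 2)) * (exp (3 * r\<^sup>2 * (norm v)\<^sup>2 / t) * exp (- (norm z)\<^sup>2 / (4 * (2 * t))))"
      by (rule mult_left_mono) simp
    \<comment> \<open>The change of normalisation from \<open>t\<close> to \<open>2 * t\<close> is
      the source of the dimensional factor.\<close>
    moreover have "(4 * pi * t) powr (- (real CARD('d) / 2)) =
        2 powr (real CARD('d) / 2) * (4 * pi * (2 * t)) powr (- (real CARD('d) / 2))"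
    proof -
      have "c powr (- h) = 2 powr h * (2 * c) powr (- h)" if "0 < c" for c h :: real
        using that by (simp add: powr_mult powr_minus)
      from this[of "4 * pi * t"] show ?thesis using t by (simp add: mult.left_commute)
    qed
    ultimately show "heat_kernel t z * exp (2 * r * (\<bar>a\<bar> + \<bar>b\<bar>))
        \<le> 2 powr (real CARD('d) / 2) * exp (3 * r\<^sup>2 * (norm v)\<^sup>2 / t) * heat_kernel (2 * t) z"
      unfolding heat_kernel_def by (simp only: mult_ac)
    show "0 \<le> W / r ^ M" using r by (auto simp: W_def intro!: divide_nonneg_nonneg sum_nonneg)
  qed
  finally show ?thesis by (simp add: W_def)
qed

text \<open>The kernel estimate is integrated against \<open>f\<close>; the majorant is a multiple
  of the kernel at time \<open>2 * t\<close>, whose integral is 1 for every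
  \<open>x\<close>.\<close>

lemma gauss_weierstrass_quadrature:
  fixes f :: "(real ^ 'd) \<Rightarrow>\<^sub>C 'b::euclidean_space" and w s :: "nat \<Rightarrow> real"
  assumes exact: "\<forall>P. degree P < 2 * M \<longrightarrow> (\<Sum>i<N. w i * poly P (s i)) = poly P 0"
    and s: "\<forall>i<N. s i \<in> {0..1}" and M: "1 \<le> M" and r: "1 \<le> r" and t: "0 < t"
  shows "norm (gauss_weierstrass t f x - (\<Sum>i<N. w i *\<^sub>R gauss_weierstrass t f (x + s i *\<^sub>R v))) \<le>
    (\<Sum>i<N. \<bar>w i\<bar>) * (2 powr (real CARD('d) / 2) * exp (3 * r\<^sup>2 * (norm v)\<^sup>2 / t) / r ^ M) * norm f"
proof -
  define B where "B = (\<Sum>i<N. \<bar>w i\<bar>) * (2 powr (real CARD('d) / 2) * exp (3 * r\<^sup>2 * (norm v)\<^sup>2 / t) / r ^ M)"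
  let ?K = "\<lambda>y. heat_kernel t (x - y) - (\<Sum>i<N. w i * heat_kernel t (x - y + s i *\<^sub>R v))"
  have int: "integrable lborel (\<lambda>y. heat_kernel t (x - y + c) *\<^sub>R f y)" for c
    using integrable_heat_kernel_bcontfun[OF t, of "x + c" f] by (simp add: algebra_simps)
  \<comment> \<open>The added 0 gives the first integral the shape of \<open>int\<close>.\<close>
  have "gauss_weierstrass t f x - (\<Sum>i<N. w i *\<^sub>R gauss_weierstrass t f (x + s i *\<^sub>R v)) =
      (\<integral>y. heat_kernel t (x - y + 0) *\<^sub>R f y \<partial>lborel) -
      (\<Sum>i<N. w i *\<^sub>R (\<integral>y. heat_kernel t (x - y + s i *\<^sub>R v) *\<^sub>R f y \<partial>lborel))"
    using t by (simp add: gauss_weierstrass_apply conv_def algebra_simps)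
  also have "\<dots> = (\<integral>y. heat_kernel t (x - y + 0) *\<^sub>R f y -
      (\<Sum>i<N. w i *\<^sub>R heat_kernel t (x - y + s i *\<^sub>R v) *\<^sub>R f y) \<partial>lborel)"
    using int[of 0] int
    by (subst Bochner_Integration.integral_diff)
      (auto simp del: scaleR_scaleR simp: Bochner_Integration.integral_sum integral_scaleR_right)
  also have "\<dots> = (\<integral>y. ?K y *\<^sub>R f y \<partial>lborel)"
    by (simp add: scaleR_diff_left scaleR_sum_left)
  also have "norm \<dots> \<le> (\<integral>y. B * norm f * heat_kernel (2 * t) (x - y) \<partial>lborel)"
  proof (rule Bochner_Integration.integral_norm_bound_integral)
    show int': "integrable lborel (\<lambda>y. B * norm f * heat_kernel (2 * t) (x - y))"
      using t by (intro integrable_mult_right integrable_heat_kernel_shift) auto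
    show le: "norm (?K y *\<^sub>R f y) \<le> B * norm f * heat_kernel (2 * t) (x - y)" for y
    proof -
      have "\<bar>?K y\<bar> * norm (f y) \<le> (B * heat_kernel (2 * t) (x - y)) * norm f"
        unfolding B_def
        using heat_kernel_quadrature[OF exact s M r t, of "x - y" v] t
        by (intro mult_mono norm_bounded)
          (auto intro!: mult_nonneg_nonneg divide_nonneg_nonneg sum_nonneg heat_kernel_nonneg)
      then show ?thesis by (simp add: mult_ac)
    qed
    show "integrable lborel (\<lambda>y. ?K y *\<^sub>R f y)"
      using le by (intro Bochner_Integration.integrable_bound[OF int'] AE_I2)
        (auto intro: order.trans[OF _ abs_ge_self])
  qed
  also have "\<dots> = B * norm f" using t by (simp add: integral_heat_kernel_shift)
  finally show ?thesis by (simp add: B_def)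
qed

text \<open>
  Fubini on \<open>box 0 (2 *\<^sub>R L) \<times> {1/2..1}\<close>: for fixed \<open>s \<ge> 1/2\<close> the points \<open>x + s *\<^sub>R v\<close> cover \<open>x + box 0 L\<close>,
  in which \<open>\<Omega>\<close> has density at least \<open>\<rho>\<close>. This replaces polar coordinates around \<open>x\<close>.
\<close>

lemma thick_segments:
  fixes \<Omega> :: "(real ^ 'd) set"
  assumes "thick \<Omega>"
  obtains \<delta> V where "0 < \<delta>"
    "\<And>x. \<exists>v E. norm v \<le> V \<and> E \<in> sets lborel \<and> E \<subseteq> {0..1} \<and> \<delta> < measure lborel E \<and> (\<forall>s\<in>E. x + s *\<^sub>R v \<in> \<Omega>)"
proof -
  obtain L :: "real ^ 'd" and \<rho> where \<Omega>: "\<Omega> \<in> sets lebesgue" and L: "\<And>j. 0 < L $ j" and \<rho>: "0 < \<rho>"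
    and dense: "\<And>x. \<rho> * measure lebesgue (box 0 L) \<le> measure lebesgue (\<Omega> \<inter> (+) x ` box 0 L)"
    using assms unfolding thick_def by blast
  \<comment> \<open>A Borel set \<open>C\<close> inside \<open>\<Omega>\<close> of the same measure
    is used, because Fubini and the line sections \<open>E v\<close> call for Borel
    measurability.\<close>
  obtain C T where C: "fsigma C" and T: "T \<in> null_sets lebesgue" and CT: "C \<union> T = \<Omega>"
    using lebesgue_set_almost_fsigma[OF \<Omega>] by metis
  have [measurable]: "C \<in> sets borel" using C by (cases rule: fsigma.cases) auto
  have [measurable]: "(+) x ` box 0 L \<in> sets borel" for x
    by (intro borel_open open_translation open_box)
  define p where "p = measure lborel (box 0 L)"
  define Q where "Q = box 0 (2 *\<^sub>R L)"
  have p: "p = (\<Prod>b\<in>Basis. L \<bullet> b)" "measure lborel Q = (\<Prod>b\<in>(Basis :: (real^'d) set). 2 * (L \<bullet> b))"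
    using L by (auto simp: p_def Q_def measure_lborel_box_eq Basis_vec_def inner_axis less_imp_le)
  then have Q: "measure lborel Q = 2 ^ CARD('d) * p" by (simp add: prod.distrib)
  have "0 < p" unfolding p using L by (intro prod_pos) (auto simp: Basis_vec_def inner_axis)
  have dense': "\<rho> * p \<le> measure lborel (C \<inter> (+) x ` box 0 L)" for x
  proof -
    let ?B = "(+) x ` box 0 L"
    have TB: "T \<inter> ?B \<in> null_sets lebesgue"
      using T by (rule null_set_Int2) auto
    have "\<rho> * p \<le> measure lebesgue ((C \<inter> ?B) \<union> (T \<inter> ?B))"
      using dense[of x] by (simp add: p_def CT[symmetric] Int_Un_distrib2)
    also have "\<dots> = measure lebesgue (C \<inter> ?B)"
      using TB by (intro measure_Un_null_set) auto
    also have "\<dots> = measure lborel (C \<inter> ?B)"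
      by (intro measure_completion) auto
    finally show ?thesis .
  qed
  \<comment> \<open>If every section had measure at most \<open>\<delta>\<close>, the double
    integral would be at most \<open>\<delta>\<close> times the measure of \<open>Q\<close>, that is
    \<open>\<rho> * p / 4\<close>; the density bound forces at least
    \<open>\<rho> * p / 2\<close>.\<close>
  define \<delta> where "\<delta> = \<rho> / (4 * 2 ^ CARD('d))"
  have "0 < \<delta>" using \<rho> by (simp add: \<delta>_def)
  show ?thesis
  proof (rule that[OF \<open>0 < \<delta>\<close>])
    fix x
    define E where "E v = {s \<in> {1/2..1}. x + s *\<^sub>R v \<in> C}" for v
    have E: "E v \<in> sets lborel" "E v \<subseteq> {0..1}" "\<And>s. s \<in> E v \<Longrightarrow> x + s *\<^sub>R v \<in> \<Omega>" for v
      unfolding E_def using CT by auto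
    have finE: "emeasure lborel (E v) = measure lborel (E v)" for v
      using emeasure_bounded_finite[OF bounded_subset[OF bounded_closed_interval E(2)[of v]]]
      by (simp add: emeasure_eq_ennreal_measure)
    let ?f = "\<lambda>(v, s). indicator Q v * (indicator {1/2..1} s * indicator C (x + s *\<^sub>R v)) :: ennreal"
    have Qm[measurable]: "Q \<in> sets borel" by (simp add: Q_def)
    have "\<exists>v\<in>Q. \<delta> < measure lborel (E v)"
    proof (rule ccontr)
      assume "\<not> ?thesis"
      then have small: "measure lborel (E v) \<le> \<delta>" if "v \<in> Q" for v using that by force
      have "(\<integral>\<^sup>+ v. \<integral>\<^sup>+ s. ?f (v, s) \<partial>lborel \<partial>lborel) = (\<integral>\<^sup>+ v. indicator Q v * emeasure lborel (E v) \<partial>lborel)"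
      proof (rule nn_integral_cong)
        fix v
        have "(\<integral>\<^sup>+ s. ?f (v, s) \<partial>lborel) = indicator Q v * (\<integral>\<^sup>+ s. indicator {1/2..1} s * indicator C (x + s *\<^sub>R v) \<partial>lborel)"
          by (simp add: nn_integral_cmult)
        also have "(\<lambda>s. indicator {1/2..1} s * indicator C (x + s *\<^sub>R v)) = (indicator (E v) :: _ \<Rightarrow> ennreal)"
          by (auto simp: E_def indicator_def)
        also have "integral\<^sup>N lborel (indicator (E v)) = emeasure lborel (E v)"
          using E by (intro nn_integral_indicator) auto
        finally show "(\<integral>\<^sup>+ s. ?f (v, s) \<partial>lborel) = indicator Q v * emeasure lborel (E v)" .
      qed
      also have "\<dots> \<le> (\<integral>\<^sup>+ v. ennreal \<delta> * indicator Q v \<partial>lborel)"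
        using small by (intro nn_integral_mono) (auto simp: indicator_def finE ennreal_leI)
      also have "\<dots> = ennreal \<delta> * emeasure lborel Q" by (simp add: nn_integral_cmult)
      also have "emeasure lborel Q = ennreal (2 ^ CARD('d) * p)"
        unfolding Q[symmetric] Q_def by (intro emeasure_eq_ennreal_measure less_imp_neq[OF emeasure_lborel_box_finite, unfolded infinity_ennreal_def])
      also have "ennreal \<delta> * ennreal (2 ^ CARD('d) * p) = ennreal (\<rho> * p / 4)"
        using \<open>0 < \<delta>\<close> \<open>0 < p\<close> by (simp add: ennreal_mult[symmetric] \<delta>_def)
      finally have upper: "(\<integral>\<^sup>+ v. \<integral>\<^sup>+ s. ?f (v, s) \<partial>lborel \<partial>lborel) \<le> ennreal (\<rho> * p / 4)" .
      have inner: "ennreal (\<rho> * p) \<le> (\<integral>\<^sup>+ v. indicator Q v * indicator C (x + s *\<^sub>R v) \<partial>lborel)"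
        if s: "s \<in> {1/2..1}" for s
      proof -
        let ?A = "C \<inter> (+) x ` box 0 L"
        have "ennreal (\<rho> * p) \<le> ennreal (measure lborel ?A)" using dense' by (rule ennreal_leI)
        also have "\<dots> = emeasure lborel ?A"
        proof (rule emeasure_eq_ennreal_measure[symmetric])
          have "bounded ?A" by (intro bounded_Int disjI2 bounded_translation bounded_box)
          then show "emeasure lborel ?A \<noteq> top" using emeasure_bounded_finite[of ?A] by simp
        qed
        also have "\<dots> = (\<integral>\<^sup>+ y. indicator ?A y \<partial>lborel)" by simp
        \<comment> \<open>Substitution \<open>y = x + s *\<^sub>R v\<close>. Its Jacobian is at most
          1 and is dropped below, while \<open>s\<close> being at least 1/2 keeps \<open>v\<close>
          inside the doubled box \<open>Q\<close>.\<close>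
        also have "\<dots> = (\<integral>\<^sup>+ y. indicator ?A y
            \<partial>density (distr lborel borel (\<lambda>v. x + s *\<^sub>R v)) (\<lambda>_. \<bar>s\<bar> ^ CARD('d)))"
          using s lborel_affine[of s x] by simp
        also have "\<dots> = (\<integral>\<^sup>+ v. ennreal (\<bar>s\<bar> ^ CARD('d)) * indicator ?A (x + s *\<^sub>R v) \<partial>lborel)"
          by (subst nn_integral_density, measurable, subst nn_integral_distr, measurable)
        also have "\<dots> \<le> (\<integral>\<^sup>+ v. indicator Q v * indicator C (x + s *\<^sub>R v) \<partial>lborel)"
        proof (rule nn_integral_mono)
          fix v
          have "v \<in> Q" if "s *\<^sub>R v \<in> box 0 L"
          proof -
            have "0 < v $ j \<and> v $ j < 2 * L $ j" for j
            proof -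
              have "0 < s * v $ j" "s * v $ j < L $ j" using that by (auto simp: mem_box_cart)
              moreover from this s have "0 < v $ j" by (auto simp: zero_less_mult_iff)
              moreover from this s have "1/2 * v $ j \<le> s * v $ j" by (intro mult_right_mono) auto
              ultimately show ?thesis by linarith
            qed
            then show ?thesis by (auto simp: Q_def mem_box_cart)
          qed
          moreover have "ennreal (\<bar>s\<bar> ^ CARD('d)) \<le> 1" using s by (simp add: power_le_one)
          ultimately show "ennreal (\<bar>s\<bar> ^ CARD('d)) * indicator ?A (x + s *\<^sub>R v) \<le> indicator Q v * indicator C (x + s *\<^sub>R v)"
            by (auto simp: indicator_def)
        qed
        finally show ?thesis .
      qed
      have "ennreal (\<rho> * p / 2) = (\<integral>\<^sup>+ s. ennreal (\<rho> * p) * indicator {1/2..1::real} s \<partial>lborel)"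
      proof -
        have "emeasure lborel {1/2..1::real} = ennreal (1/2)" by (subst emeasure_lborel_Icc) auto
        moreover have "ennreal (\<rho> * p / 2) = ennreal (\<rho> * p) * ennreal (1/2)"
          using \<rho> \<open>0 < p\<close> by (subst ennreal_mult[symmetric]) auto
        ultimately show ?thesis by (subst nn_integral_cmult_indicator) auto
      qed
      also have "\<dots> \<le> (\<integral>\<^sup>+ s. \<integral>\<^sup>+ v. ?f (v, s) \<partial>lborel \<partial>lborel)"
      proof (rule nn_integral_mono)
        fix s :: real
        show "ennreal (\<rho> * p) * indicator {1/2..1} s \<le> (\<integral>\<^sup>+ v. ?f (v, s) \<partial>lborel)"
          using inner[of s] by (auto simp: indicator_def)
      qed
      also have "\<dots> = (\<integral>\<^sup>+ v. \<integral>\<^sup>+ s. ?f (v, s) \<partial>lborel \<partial>lborel)"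
        by (rule lborel_pair.Fubini) measurable
      also note upper
      finally show False using \<rho> \<open>0 < p\<close> by (simp add: ennreal_le_iff field_simps)
    qed
    then obtain v where v: "v \<in> Q" "\<delta> < measure lborel (E v)" by blast
    have "norm v \<le> norm (2 *\<^sub>R L)"
    proof (rule norm_le_componentwise_cart)
      fix j show "norm (v $ j) \<le> norm ((2 *\<^sub>R L) $ j)"
        using v(1) unfolding Q_def mem_box_cart by (auto dest: spec[of _ j])
    qed
    then show "\<exists>v E. norm v \<le> norm (2 *\<^sub>R L) \<and> E \<in> sets lborel \<and> E \<subseteq> {0..1} \<and> \<delta> < measure lborel E \<and> (\<forall>s\<in>E. x + s *\<^sub>R v \<in> \<Omega>)"
      by (intro exI[of _ v] exI[of _ "E v"] conjI ballI E v(2))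
  qed
qed

section \<open>Elementary bounds for the observed norm, and the interpolation inequality\<close>

lemma norm_le_Cb_norm_obs: "z \<in> \<Omega> \<Longrightarrow> norm (apply_bcontfun f z) \<le> Cb_norm \<Omega> (obs \<Omega> f)"
  unfolding Cb_norm_def obs_def
  by (rule order.trans[OF _ cSUP_upper[of z]]) (auto intro!: bdd_aboveI[of _ "norm f"] norm_bounded)

lemma Cb_norm_obs_le:
  assumes "\<Omega> \<noteq> {}"
  shows "Cb_norm \<Omega> (obs \<Omega> f) \<le> norm f"
  unfolding Cb_norm_def obs_def using assms by (intro cSUP_least) (auto intro: norm_bounded)

lemma Cb_norm_obs_nonneg:
  assumes "\<Omega> \<noteq> {}"
  shows "0 \<le> Cb_norm \<Omega> (obs \<Omega> f)"
  using assms norm_le_Cb_norm_obs order.trans[OF norm_ge_zero] by blast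

text \<open>Supplies the nonemptiness required by the bounds on \<open>Cb_norm\<close>, where a
  supremum over the empty set would carry no information.\<close>

lemma thick_nonempty:
  fixes \<Omega> :: "(real ^ 'd) set"
  assumes "thick \<Omega>"
  shows "\<Omega> \<noteq> {}"
proof
  assume "\<Omega> = {}"
  then obtain L :: "real ^ 'd" and \<rho> :: real where L: "\<forall>j. 0 < L $ j" "0 < \<rho>"
    and "\<rho> * measure lebesgue (box 0 L) \<le> 0"
    using assms unfolding thick_def by auto
  moreover have "0 < measure lebesgue (box 0 L)"
    using L by (auto simp: measure_lborel_box_eq Basis_vec_def inner_axis less_imp_le intro!: prod_pos)
  ultimately show False by (simp add: mult_le_0_iff)
qed

lemma thick_interpolation:
  fixes \<Omega> :: "(real ^ 'd) set"
  assumes "thick \<Omega>"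
  obtains \<Lambda> V where "1 \<le> \<Lambda>"
    "\<And>M r t (f :: (real ^ 'd) \<Rightarrow>\<^sub>C 'b::euclidean_space). 1 \<le> M \<Longrightarrow> 1 \<le> r \<Longrightarrow> 0 < t \<Longrightarrow>
      norm (gauss_weierstrass t f) \<le> \<Lambda> ^ M * (Cb_norm \<Omega> (obs \<Omega> (gauss_weierstrass t f)) +
        2 powr (real CARD('d) / 2) * exp (3 * r\<^sup>2 * V\<^sup>2 / t) / r ^ M * norm f)"
proof -
  obtain \<delta> V where \<delta>: "0 < \<delta>" and seg:
    "\<And>x. \<exists>v E. norm v \<le> V \<and> E \<in> sets lborel \<and> E \<subseteq> {0..1} \<and> \<delta> < measure lborel E \<and> (\<forall>s\<in>E. x + s *\<^sub>R v \<in> \<Omega>)"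
    using thick_segments[OF assms] by metis
  \<comment> \<open>The square accounts for the \<open>2 * M\<close> nodes; the maximum guarantees
    \<open>1 \<le> \<Lambda>\<close>, which the telescoping relies on.\<close>
  define \<Lambda> where "\<Lambda> = max 1 ((2 * exp 1 / \<delta>)\<^sup>2)"
  show ?thesis
  proof (rule that)
    show "1 \<le> \<Lambda>" by (simp add: \<Lambda>_def)
    fix M :: nat and r t :: real and f :: "(real ^ 'd) \<Rightarrow>\<^sub>C 'b"
    assume M: "1 \<le> M" and r: "1 \<le> r" and t: "0 < t"
    define u where "u = gauss_weierstrass t f"
    define G where "G = Cb_norm \<Omega> (obs \<Omega> u)"
    define B where "B a = 2 powr (real CARD('d) / 2) * exp (3 * r\<^sup>2 * a\<^sup>2 / t) / r ^ M" for a :: real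
    show "norm u \<le> \<Lambda> ^ M * (G + B V * norm f)"
    proof (rule norm_bound)
      fix x
      obtain v E where v: "norm v \<le> V" and E: "E \<in> sets lborel" "E \<subseteq> {0..1}" "\<delta> < measure lborel E"
        and E\<Omega>: "\<And>s. s \<in> E \<Longrightarrow> x + s *\<^sub>R v \<in> \<Omega>"
        using seg[of x] by blast
      obtain w s where s: "\<forall>i<2 * M. s i \<in> E"
        and exact: "\<forall>P. degree P < 2 * M \<longrightarrow> (\<Sum>i<2 * M. w i * poly P (s i)) = poly P 0"
        and W: "(\<Sum>i<2 * M. \<bar>w i\<bar>) \<le> (2 * exp 1 / \<delta>) ^ (2 * M)"
        using quadrature_weights[OF E \<delta>, of "2 * M"] M by auto
      define S where "S = (\<Sum>i<2 * M. \<bar>w i\<bar>)"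
      have S: "0 \<le> S" "S \<le> \<Lambda> ^ M"
        using W by (auto simp: S_def \<Lambda>_def power_mult intro!: sum_nonneg order.trans[OF W] power_mono)
      have s01: "\<forall>i<2 * M. s i \<in> {0..1}" using s E(2) by blast
      have "norm (u x) \<le> norm (\<Sum>i<2 * M. w i *\<^sub>R u (x + s i *\<^sub>R v)) +
          norm (u x - (\<Sum>i<2 * M. w i *\<^sub>R u (x + s i *\<^sub>R v)))"
        by (rule norm_triangle_sub)
      also have "norm (\<Sum>i<2 * M. w i *\<^sub>R u (x + s i *\<^sub>R v)) \<le> (\<Sum>i<2 * M. \<bar>w i\<bar> * G)"
        using s E\<Omega> by (intro sum_norm_le) (auto simp: G_def intro!: mult_left_mono norm_le_Cb_norm_obs)
      also have "\<dots> = S * G" by (simp add: S_def sum_distrib_right)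
      also have "norm (u x - (\<Sum>i<2 * M. w i *\<^sub>R u (x + s i *\<^sub>R v))) \<le> S * B (norm v) * norm f"
        unfolding u_def S_def B_def by (rule gauss_weierstrass_quadrature[OF exact s01 M r t])
      also have "S * G + S * B (norm v) * norm f = S * (G + B (norm v) * norm f)"
        by (simp add: algebra_simps)
      also have "\<dots> \<le> \<Lambda> ^ M * (G + B V * norm f)"
      proof (intro mult_mono add_mono order_refl)
        show "B (norm v) \<le> B V"
          unfolding B_def using v t r
          by (intro divide_right_mono mult_left_mono iffD2[OF exp_le_cancel_iff] power_mono) auto
        have "0 \<le> G" unfolding G_def by (intro Cb_norm_obs_nonneg thick_nonempty assms)
        moreover have "0 \<le> B (norm v)" using r by (simp add: B_def)
        ultimately show "0 \<le> G + B (norm v) * norm f" by simp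
      qed (use S r in \<open>auto simp: \<Lambda>_def B_def\<close>)
      finally show "norm (u x) \<le> \<Lambda> ^ M * (G + B V * norm f)" by simp
    qed
  qed
qed

section \<open>Observability\<close>

text \<open>The real-variable core: \<open>F\<close> stands for the norm of the solution and
  \<open>G\<close> for its observed norm. \<open>K\<close> is fixed before \<open>F\<close> and
  \<open>G\<close>, so it is uniform in the initial datum.\<close>

lemma telescoping_observability:
  fixes T \<Lambda> c C :: real
  assumes T: "0 < T" and \<Lambda>: "1 \<le> \<Lambda>" and c: "0 \<le> c" and C: "0 \<le> C"
  obtains K where "0 \<le> K"
    "\<And>F G. G integrable_on {0..T} \<Longrightarrow> (\<And>t. 0 \<le> G t) \<Longrightarrow> (\<And>t. 0 \<le> F t) \<Longrightarrow>
      (\<And>s t. 0 \<le> s \<Longrightarrow> s \<le> t \<Longrightarrow> F t \<le> F s) \<Longrightarrow>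
      (\<And>s t M. 0 \<le> s \<Longrightarrow> s < t \<Longrightarrow> 1 \<le> M \<Longrightarrow>
        F t \<le> \<Lambda> ^ M * G t + c * exp (C / (t - s)) / (exp 1 * \<Lambda>) ^ M * F s) \<Longrightarrow>
      F T \<le> K * integral {0..T} G"
proof -
  \<comment> \<open>Chosen so that \<open>exp (M n)\<close> dominates
    \<open>2 * c * exp (4 * C / l n)\<close> for all \<open>n\<close>: both \<open>M n\<close> and
    \<open>1 / l n\<close> double in each step. \<open>Suc\<close> ensures
    \<open>1 \<le> M n\<close>.\<close>
  define m where "m = Suc (nat \<lceil>4 * C / T + ln (2 * c + 1)\<rceil>)"
  have m: "4 * C / T + ln (2 * c + 1) \<le> real m"
    unfolding m_def by linarith
  define M where "M n = m * 2 ^ n" for n :: nat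
  define l where "l n = T / 2 ^ n" for n :: nat
  \<comment> \<open>\<open>M (Suc n) = 2 * M n\<close>, so these weights turn the step from \<open>l (Suc n)\<close> to \<open>l n\<close> into a telescoping
    inequality, the error \<open>exp (4 * C / l n)\<close> being absorbed by \<open>exp (M n)\<close>\<close>
  define a where "a n = l n / 4 / \<Lambda> ^ M n" for n
  have l: "0 < l n" "l n \<le> T" "l (Suc n) = l n / 2" for n
    using T by (auto simp: l_def divide_le_eq)
  have c_bound: "2 * c * exp (4 * C / l n) \<le> exp 1 ^ M n" for n
  proof -
    have "ln (2 * c + 1) * 1 \<le> ln (2 * c + 1) * 2 ^ n" using c by (intro mult_left_mono) auto
    then have "4 * C / l n + ln (2 * c + 1) \<le> (4 * C / T + ln (2 * c + 1)) * 2 ^ n"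
      by (simp add: l_def algebra_simps)
    also have "\<dots> \<le> real (M n)" using m by (simp add: M_def)
    finally have "exp (4 * C / l n + ln (2 * c + 1)) \<le> exp (real (M n))" by simp
    then have "exp (4 * C / l n) * (2 * c + 1) \<le> exp 1 ^ M n"
      using c by (simp add: exp_add exp_of_nat_mult[of _ "1::real", simplified])
    then show ?thesis by (simp add: algebra_simps) (smt (verit) exp_gt_zero)
  qed
  show ?thesis
  proof (rule that)
    show "0 \<le> 1 / a 0" using l[of 0] \<Lambda> by (simp add: a_def)
    fix F G :: "real \<Rightarrow> real"
    assume int: "G integrable_on {0..T}" and G: "\<And>t. 0 \<le> G t" and F: "\<And>t. 0 \<le> F t"
      and mono: "\<And>s t. 0 \<le> s \<Longrightarrow> s \<le> t \<Longrightarrow> F t \<le> F s"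
      and step: "\<And>s t M. 0 \<le> s \<Longrightarrow> s < t \<Longrightarrow> 1 \<le> M \<Longrightarrow>
        F t \<le> \<Lambda> ^ M * G t + c * exp (C / (t - s)) / (exp 1 * \<Lambda>) ^ M * F s"
    have int': "G integrable_on {x..y}" if "0 \<le> x" "y \<le> T" for x y
      using int by (rule integrable_on_subinterval) (use that in auto)
    have one: "a n * F (l n) \<le> integral {l (Suc n)..l n} G + a (Suc n) * F (l (Suc n))" for n
    proof -
      define p where "p = \<Lambda> ^ M n"
      have p: "1 \<le> p" using \<Lambda> by (simp add: p_def)
      have M1: "1 \<le> M n" unfolding M_def m_def by (metis One_nat_def Suc_leI nat_0_less_mult_iff zero_less_Suc zero_less_numeral zero_less_power)
      \<comment> \<open>On this last quarter \<open>t\<close> stays at distance at least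
        \<open>l n / 4\<close> from \<open>l (Suc n)\<close>, which bounds the exponent by
        \<open>4 * C / l n\<close>.\<close>
      have le: "F (l n) / p - F (l (Suc n)) / p\<^sup>2 / 2 \<le> G t" if t: "t \<in> {3 / 4 * l n..l n}" for t
      proof -
        have ts: "l n / 4 \<le> t - l (Suc n)" using t l(3)[of n] by auto
        then have "C / (t - l (Suc n)) \<le> C / (l n / 4)"
          using C l[of n] by (intro divide_left_mono mult_pos_pos) auto
        then have "2 * c * exp (C / (t - l (Suc n))) \<le> 2 * c * exp (4 * C / l n)"
          using c by (intro mult_left_mono) (auto simp: mult.commute)
        also note c_bound
        finally have "c * exp (C / (t - l (Suc n))) \<le> exp 1 ^ M n / 2" by simp
        then have "c * exp (C / (t - l (Suc n))) / (exp 1 * \<Lambda>) ^ M n \<le> exp 1 ^ M n / 2 / (exp 1 * \<Lambda>) ^ M n"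
          using \<Lambda> by (intro divide_right_mono) auto
        also have "\<dots> = 1 / (2 * p)" by (simp add: power_mult_distrib p_def)
        finally have *: "c * exp (C / (t - l (Suc n))) / (exp 1 * \<Lambda>) ^ M n \<le> 1 / (2 * p)" .
        have "F (l n) \<le> F t" using t l[of n] by (intro mono) auto
        also have "\<dots> \<le> p * G t + c * exp (C / (t - l (Suc n))) / (exp 1 * \<Lambda>) ^ M n * F (l (Suc n))"
          unfolding p_def using ts l[of n] l[of "Suc n"] M1 by (intro step) auto
        also have "\<dots> \<le> p * G t + 1 / (2 * p) * F (l (Suc n))"
          using * F by (intro add_left_mono mult_right_mono) auto
        finally have "F (l n) / p \<le> (p * G t + 1 / (2 * p) * F (l (Suc n))) / p"
          using p by (intro divide_right_mono) auto
        then show ?thesis using p by (simp add: add_divide_distrib power2_eq_square)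
      qed
      \<comment> \<open>Integration over an interval of length \<open>l n / 4\<close> explains that
        factor in \<open>a n\<close>.\<close>
      have "(F (l n) / p - F (l (Suc n)) / p\<^sup>2 / 2) * (l n / 4)
          = integral {3 / 4 * l n..l n} (\<lambda>t. F (l n) / p - F (l (Suc n)) / p\<^sup>2 / 2)"
        using l[of n] by (simp add: content_real)
      also have "\<dots> \<le> integral {3 / 4 * l n..l n} G"
        by (intro integral_le int' le) (use l(1,2)[of n] in auto)
      also have "\<dots> \<le> integral {l (Suc n)..l n} G"
        using l[of n] l[of "Suc n"] G by (intro integral_subset_le int') auto
      finally have "(F (l n) / p - F (l (Suc n)) / p\<^sup>2 / 2) * (l n / 4) \<le> integral {l (Suc n)..l n} G" (is ?A) .
      then have "l n / 4 / p * F (l n) \<le> integral {l (Suc n)..l n} G + l (Suc n) / 4 / p\<^sup>2 * F (l (Suc n))"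
      proof -
        \<comment> \<open>The factor 1/2 gained in the error term matches the halving of
          \<open>l\<close>, so the error carries exactly the weight
          \<open>a (Suc n)\<close>.\<close>
        have l8: "l (Suc n) / 4 / p\<^sup>2 = l n / 8 / p\<^sup>2" unfolding l(3) by simp
        have eq: "(A / p - B / p\<^sup>2 / 2) * (h / 4) = h / 4 / p * A - h / 8 / p\<^sup>2 * B" for A B h
          by (simp add: field_simps)
        show ?thesis using \<open>?A\<close> unfolding eq l8 by linarith
      qed
      moreover have "p\<^sup>2 = \<Lambda> ^ M (Suc n)"
        by (simp add: p_def M_def power_mult[symmetric] mult.commute mult.left_commute)
      ultimately show ?thesis by (simp add: a_def p_def)
    qed
    have many: "a 0 * F T \<le> integral {l n..T} G + a n * F (l n)" for n
    proof (induction n)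
      case 0
      then show ?case by (simp add: l_def)
    next
      case (Suc n)
      have "integral {l (Suc n)..l n} G + integral {l n..T} G = integral {l (Suc n)..T} G"
        using l[of n] l[of "Suc n"] by (intro Henstock_Kurzweil_Integration.integral_combine int') auto
      then show ?case using Suc one[of n] by linarith
    qed
    have "a 0 * F T \<le> integral {0..T} G + T * F 0 / 2 ^ n" for n
    proof -
      note many[of n]
      also have "integral {l n..T} G \<le> integral {0..T} G"
        using l[of n] G by (intro integral_subset_le int') auto
      \<comment> \<open>The remainder of the telescoped sum tends to 0, since \<open>F\<close> is
        bounded by \<open>F 0\<close>.\<close>
      also have "a n * F (l n) \<le> l n * F 0"
      proof (rule mult_mono)
        have "a n \<le> l n / 4 / 1" unfolding a_def using \<Lambda> l[of n] by (intro divide_left_mono) auto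
        then show "a n \<le> l n" using l[of n] by simp
      qed (use l[of n] mono[of 0 "l n"] F in auto)
      finally show ?thesis by (simp add: l_def)
    qed
    moreover have "(\<lambda>n. integral {0..T} G + T * F 0 / 2 ^ n) \<longlonglongrightarrow> integral {0..T} G + 0"
      by (intro tendsto_intros LIMSEQ_divide_realpow_zero) auto
    ultimately have "a 0 * F T \<le> integral {0..T} G"
      using LIMSEQ_le_const by fastforce
    moreover have "0 < a 0" using l[of 0] \<Lambda> by (simp add: a_def)
    ultimately show "F T \<le> 1 / a 0 * integral {0..T} G" by (simp add: field_simps)
  qed
qed

section \<open>Measurability in time and the observability estimate in L^1\<close>

lemma borel_measurable_Cb_norm_gauss_weierstrass:
  fixes f :: "(real ^ 'd) \<Rightarrow>\<^sub>C 'b::euclidean_space"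
  assumes "\<Omega> \<noteq> {}"
  shows "(\<lambda>t. Cb_norm \<Omega> (obs \<Omega> (gauss_weierstrass t f))) \<in> borel_measurable borel"
proof -
  \<comment> \<open>By continuity in space the supremum over \<open>\<Omega>\<close> equals the one
    over a countable dense subset, and a countable supremum preserves measurability in
    \<open>t\<close>.\<close>
  obtain D where D: "countable D" "D \<subseteq> \<Omega>" "\<Omega> \<subseteq> closure D" using separable by blast
  have "D \<noteq> {}" using D assms by auto
  have bdd: "bdd_above ((\<lambda>z. norm (apply_bcontfun u z)) ` D)" for u :: "(real ^ 'd) \<Rightarrow>\<^sub>C 'b"
    by (auto intro!: bdd_aboveI[of _ "norm u"] norm_bounded)
  have eq: "Cb_norm \<Omega> (obs \<Omega> u) = (SUP z\<in>D. norm (u z))" for u :: "(real ^ 'd) \<Rightarrow>\<^sub>C 'b"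
  proof (rule antisym)
    have "closed {z. norm (u z) \<le> (SUP z\<in>D. norm (u z))}"
      by (intro closed_Collect_le continuous_intros) auto
    moreover have "D \<subseteq> {z. norm (u z) \<le> (SUP z\<in>D. norm (u z))}"
      using bdd by (auto intro: cSUP_upper)
    ultimately have "closure D \<subseteq> {z. norm (u z) \<le> (SUP z\<in>D. norm (u z))}"
      by (intro closure_minimal)
    then show "Cb_norm \<Omega> (obs \<Omega> u) \<le> (SUP z\<in>D. norm (u z))"
      unfolding Cb_norm_def obs_def using D assms by (intro cSUP_least) auto
    show "(SUP z\<in>D. norm (u z)) \<le> Cb_norm \<Omega> (obs \<Omega> u)"
      using D \<open>D \<noteq> {}\<close> by (intro cSUP_least norm_le_Cb_norm_obs) auto
  qed
  have "(\<lambda>t. gauss_weierstrass t f z) \<in> borel_measurable borel" for z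
  proof -
    have "(\<lambda>t. if 0 < t then \<integral>y. heat_kernel t (z - y) *\<^sub>R f y \<partial>lborel else f z) \<in> borel_measurable borel"
      by measurable
    also have "(\<lambda>t. if 0 < t then \<integral>y. heat_kernel t (z - y) *\<^sub>R f y \<partial>lborel else f z) = (\<lambda>t. gauss_weierstrass t f z)"
      by (auto simp: gauss_weierstrass_apply conv_def)
    finally show ?thesis .
  qed
  then show ?thesis
    unfolding eq using D bdd by (intro borel_measurable_cSUP) auto
qed

lemma measurable_Cb_norm_gauss_weierstrass_on:
  fixes f :: "(real ^ 'd) \<Rightarrow>\<^sub>C 'b::euclidean_space"
  assumes "\<Omega> \<noteq> {}"
  shows "(\<lambda>t. Cb_norm \<Omega> (obs \<Omega> (gauss_weierstrass t f))) \<in> borel_measurable (lebesgue_on S)"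
  using borel_measurable_Cb_norm_gauss_weierstrass[OF assms, of f]
  by (intro measurable_restrict_space1 measurable_completion) simp

lemma integrable_Cb_norm_gauss_weierstrass:
  fixes f :: "(real ^ 'd) \<Rightarrow>\<^sub>C 'b::euclidean_space"
  assumes "\<Omega> \<noteq> {}"
  shows "integrable (lebesgue_on {a..b}) (\<lambda>t. Cb_norm \<Omega> (obs \<Omega> (gauss_weierstrass t f)))"
proof -
  interpret finite_measure "lebesgue_on {a..b}" by (intro finite_measure_lebesgue_on) auto
  have "norm (Cb_norm \<Omega> (obs \<Omega> (gauss_weierstrass t f))) \<le> norm f" for t
    using Cb_norm_obs_nonneg[OF assms, of "gauss_weierstrass t f"]
      order.trans[OF Cb_norm_obs_le[OF assms] norm_gauss_weierstrass_le[of t f]] by simp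
  then show ?thesis
    using measurable_Cb_norm_gauss_weierstrass_on[OF assms] by (intro integrable_const_bound AE_I2)
qed

text \<open>The interpolation inequality over time \<open>t - s\<close>, started from the state at
  time \<open>s\<close>, is the step hypothesis of the telescoping; contractivity yields the
  monotonicity of \<open>F\<close>.\<close>

lemma thick_observability_L1:
  fixes \<Omega> :: "(real ^ 'd) set"
  assumes "thick \<Omega>" "0 < T"
  obtains K where "0 \<le> K"
    "\<And>f :: (real ^ 'd) \<Rightarrow>\<^sub>C 'b::euclidean_space. norm (gauss_weierstrass T f) \<le>
      K * (\<integral>t. Cb_norm \<Omega> (obs \<Omega> (gauss_weierstrass t f)) \<partial>lebesgue_on {0..T})"
proof -
  note ne = thick_nonempty[OF assms(1)]
  obtain \<Lambda> V where \<Lambda>: "1 \<le> \<Lambda>" and interp: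
    "\<And>M r t (f :: (real ^ 'd) \<Rightarrow>\<^sub>C 'b). 1 \<le> M \<Longrightarrow> 1 \<le> r \<Longrightarrow> 0 < t \<Longrightarrow>
      norm (gauss_weierstrass t f) \<le> \<Lambda> ^ M * (Cb_norm \<Omega> (obs \<Omega> (gauss_weierstrass t f)) +
        2 powr (real CARD('d) / 2) * exp (3 * r\<^sup>2 * V\<^sup>2 / t) / r ^ M * norm f)"
    using thick_interpolation[OF assms(1)] by metis
  define c where "c = 2 powr (real CARD('d) / 2)"
  \<comment> \<open>one factor \<open>\<Lambda>\<close> compensates the \<open>\<Lambda> ^ M\<close> in front of the error, the other one is needed in the telescoping\<close>
  define r where "r = exp 1 * \<Lambda>\<^sup>2"
  define C where "C = 3 * r\<^sup>2 * V\<^sup>2"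
  have r: "1 \<le> r" unfolding r_def using \<Lambda> mult_mono[of 1 "exp 1" 1 "\<Lambda>\<^sup>2"] by simp
  have "0 \<le> c" "0 \<le> C" by (auto simp: c_def C_def)
  then obtain K where "0 \<le> K" and K: "\<And>F G. G integrable_on {0..T} \<Longrightarrow> (\<And>t. 0 \<le> G t) \<Longrightarrow> (\<And>t. 0 \<le> F t) \<Longrightarrow>
      (\<And>s t. 0 \<le> s \<Longrightarrow> s \<le> t \<Longrightarrow> F t \<le> F s) \<Longrightarrow>
      (\<And>s t M. 0 \<le> s \<Longrightarrow> s < t \<Longrightarrow> 1 \<le> M \<Longrightarrow>
        F t \<le> \<Lambda> ^ M * G t + c * exp (C / (t - s)) / (exp 1 * \<Lambda>) ^ M * F s) \<Longrightarrow>
      F T \<le> K * integral {0..T} G"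
    using telescoping_observability[OF assms(2) \<Lambda>] by metis
  show ?thesis
  proof (rule that[OF \<open>0 \<le> K\<close>])
    fix f :: "(real ^ 'd) \<Rightarrow>\<^sub>C 'b"
    define G where "G t = Cb_norm \<Omega> (obs \<Omega> (gauss_weierstrass t f))" for t
    define F where "F t = norm (gauss_weierstrass t f)" for t
    \<comment> \<open>The semigroup law was shown for positive times; at \<open>s = 0\<close> the
      operator is the identity by definition.\<close>
    have shift: "gauss_weierstrass t f = gauss_weierstrass (t - s) (gauss_weierstrass s f)"
      if "0 \<le> s" "s < t" for s t
      using that gauss_weierstrass_semigroup[of s "t - s" f]
      by (cases "s = 0") (auto simp: gauss_weierstrass_def)
    have "F T \<le> K * integral {0..T} G"
    proof (rule K)
      show "G integrable_on {0..T}"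
        unfolding G_def by (intro integrable_on_lebesgue_on integrable_Cb_norm_gauss_weierstrass ne) auto
      show "0 \<le> G t" for t unfolding G_def using ne by (rule Cb_norm_obs_nonneg)
      show "0 \<le> F t" for t by (simp add: F_def)
      show "F t \<le> F s" if "0 \<le> s" "s \<le> t" for s t
        using that norm_gauss_weierstrass_le[of "t - s" "gauss_weierstrass s f"] shift[of s t]
        by (cases "s = t") (auto simp: F_def)
      show "F t \<le> \<Lambda> ^ M * G t + c * exp (C / (t - s)) / (exp 1 * \<Lambda>) ^ M * F s"
        if "0 \<le> s" "s < t" "1 \<le> M" for s t M
      proof -
        have "F t \<le> \<Lambda> ^ M * (G t + c * exp (C / (t - s)) / r ^ M * F s)"
          using interp[OF that(3) r, of "t - s" "gauss_weierstrass s f"] that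
          by (simp add: shift[OF that(1,2), symmetric] F_def G_def c_def C_def)
        moreover have "r ^ M = \<Lambda> ^ M * (exp 1 * \<Lambda>) ^ M"
          by (simp add: r_def power2_eq_square power_mult_distrib)
        ultimately show ?thesis using \<Lambda> by (simp add: distrib_left)
      qed
    qed
    also have "integral {0..T} G = (\<integral>t. G t \<partial>lebesgue_on {0..T})"
      unfolding G_def
      by (intro lebesgue_integral_eq_integral[symmetric] integrable_Cb_norm_gauss_weierstrass ne) auto
    finally show "F T \<le> K * (\<integral>t. G t \<partial>lebesgue_on {0..T})" .
  qed
qed


section \<open>Comparison of the L^1 norm with the L^r norms and the essential supremum\<close>

lemma integral_le_Lp_norm:
  fixes g :: "real \<Rightarrow> real"
  assumes g: "integrable (lebesgue_on {0..T}) g" "integrable (lebesgue_on {0..T}) (\<lambda>t. g t powr p)"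
    and p: "1 \<le> p" and T: "0 \<le> T"
  shows "(\<integral>t. g t \<partial>lebesgue_on {0..T}) \<le> (T + 1) * (\<integral>t. g t powr p \<partial>lebesgue_on {0..T}) powr (1 / p)"
proof -
  define P where "P = (\<integral>t. g t powr p \<partial>lebesgue_on {0..T})"
  interpret finite_measure "lebesgue_on {0..T}" by (intro finite_measure_lebesgue_on) auto
  have P: "0 \<le> P" unfolding P_def by (intro integral_nonneg_AE AE_I2) auto
  \<comment> \<open>if \<open>g t > l\<close> then \<open>g t powr (1 - p) \<le> l powr (1 - p)\<close>; optimising over \<open>l\<close> replaces Hoelder's inequality\<close>
  have young: "(\<integral>t. g t \<partial>lebesgue_on {0..T}) \<le> T * l + l powr (1 - p) * P" if l: "0 < l" for l
  proof -
    have "g t \<le> l + l powr (1 - p) * g t powr p" for t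
    proof (cases "g t \<le> l")
      case False
      have "g t = g t powr (1 - p) * g t powr p" using False l by (simp add: powr_add[symmetric])
      also have "\<dots> \<le> l powr (1 - p) * g t powr p"
        using False l p by (intro mult_right_mono powr_mono2') auto
      finally show ?thesis using l by simp
    qed (use l in \<open>simp add: add_increasing2\<close>)
    then have "(\<integral>t. g t \<partial>lebesgue_on {0..T}) \<le> (\<integral>t. l + l powr (1 - p) * g t powr p \<partial>lebesgue_on {0..T})"
      using g by (intro integral_mono Bochner_Integration.integrable_add integrable_mult_right) auto
    also have "\<dots> = T * l + l powr (1 - p) * P"
      using g T by (simp add: P_def measure_restrict_space)
    finally show ?thesis .
  qed
  show ?thesis
  \<comment> \<open>The optimal \<open>l\<close> is \<open>P powr (1 / p)\<close>, which is not
    admissible for \<open>P = 0\<close>; there \<open>l\<close> is sent to 0 instead.\<close>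
  proof (cases "P = 0")
    case True
    have "(\<integral>t. g t \<partial>lebesgue_on {0..T}) \<le> 0"
    proof (rule field_le_epsilon)
      fix e :: real assume "0 < e"
      then have "(\<integral>t. g t \<partial>lebesgue_on {0..T}) \<le> T * (e / (T + 1))"
        using young[of "e / (T + 1)"] T True by simp
      also have "\<dots> \<le> e" using T \<open>0 < e\<close> by (simp add: field_simps)
      finally show "(\<integral>t. g t \<partial>lebesgue_on {0..T}) \<le> 0 + e" by simp
    qed
    then show ?thesis using True by (simp add: P_def)
  next
    case False
    then have "0 < P" using P by simp
    \<comment> \<open>With this \<open>l\<close> the second term of \<open>young\<close> equals
      \<open>l\<close> itself, so the two terms add up to \<open>(T + 1) * l\<close>.\<close>
    have "(P powr (1 / p)) powr (1 - p) * P = P powr ((1 - p) / p) * P powr 1"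
      using \<open>0 < P\<close> by (simp add: powr_powr)
    also have "\<dots> = P powr ((1 - p) / p + 1)" by (rule powr_add[symmetric])
    also have "(1 - p) / p + 1 = 1 / p" using p by (simp add: field_simps)
    finally show ?thesis
      using young[of "P powr (1 / p)"] \<open>0 < P\<close> by (simp add: P_def[symmetric] distrib_right)
  qed
qed

lemma integral_le_esssup:
  fixes g :: "real \<Rightarrow> real"
  assumes g: "integrable (lebesgue_on {0..T}) g" and nonneg: "\<And>t. 0 \<le> g t" and T: "0 < T" and K: "0 \<le> K"
  shows "ereal (K * (\<integral>t. g t \<partial>lebesgue_on {0..T})) \<le> ereal ((T + 1) * K) * esssup (lebesgue_on {0..T}) (\<lambda>t. ereal (g t))"
proof -
  interpret finite_measure "lebesgue_on {0..T}" by (intro finite_measure_lebesgue_on) auto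
  define e where "e = esssup (lebesgue_on {0..T}) (\<lambda>t. ereal (g t))"
  have ae: "AE t in lebesgue_on {0..T}. ereal (g t) \<le> e" unfolding e_def by (rule esssup_AE)
  \<comment> \<open>Since \<open>{0..T}\<close> is not null, the almost everywhere bound holds at
    some \<open>t\<close>; nonnegativity of \<open>g\<close> then rules out negative
    \<open>e\<close>, in particular minus infinity.\<close>
  have "\<exists>t. ereal (g t) \<le> e"
  proof (rule ccontr)
    assume "\<not> ?thesis"
    then have "AE t in lebesgue_on {0..T}. False" using ae by auto
    then have "emeasure (lebesgue_on {0..T}) (space (lebesgue_on {0..T})) = 0"
      using ae_filter_eq_bot_iff trivial_limit_def by metis
    then show False using T by (simp add: emeasure_restrict_space space_restrict_space)
  qed
  then have e0: "0 \<le> e" using nonneg by (meson ereal_less_eq(5) order.trans)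
  show ?thesis
  proof (cases e)
    case (real x)
    have "(\<integral>t. g t \<partial>lebesgue_on {0..T}) \<le> (\<integral>t. x \<partial>lebesgue_on {0..T})"
      using g ae by (intro integral_mono_AE) (auto simp: real)
    also have "\<dots> = T * x" using T by (simp add: measure_restrict_space)
    also have "\<dots> \<le> (T + 1) * x" using e0 real by (simp add: distrib_right)
    finally have "K * (\<integral>t. g t \<partial>lebesgue_on {0..T}) \<le> K * ((T + 1) * x)" using K by (rule mult_left_mono)
    then show ?thesis unfolding e_def[symmetric] real by (simp add: mult_ac)
  next
    case PInf
    show ?thesis
    \<comment> \<open>In \<open>ereal\<close> the product of 0 and infinity is 0, so
      \<open>K = 0\<close> needs its own argument: the left side vanishes too.\<close>
    proof (cases "K = 0")
      case False
      then have "0 < (T + 1) * K" using K T by simp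
      then show ?thesis unfolding e_def[symmetric] PInf by simp
    qed (auto simp: zero_ereal_def[symmetric])
  qed (use e0 in simp)
qed

text \<open>Every exponent reduces to the L^1 estimate because \<open>{0..T}\<close> has finite
  measure, and the same constant \<open>(T + 1) * K\<close> serves all \<open>r\<close>. The type
  \<open>'k\<close> covers real and complex scalars alike.\<close>

theorem mainTheorem2:
  fixes \<Omega> :: "(real ^ 'd) set" and T :: real and r :: ereal
  assumes "thick \<Omega>" and "0 < T" and "1 \<le> r"
  shows "\<exists>C_obs::real. 0 \<le> C_obs \<and>
    (\<forall>f :: (real ^ 'd) \<Rightarrow>\<^sub>C 'k::{real_normed_field, euclidean_space}.
       if r < \<infinity>
       then norm (gauss_weierstrass T f)
              \<le> C_obs * (\<integral>t. Cb_norm \<Omega> (obs \<Omega> (gauss_weierstrass t f)) powr real_of_ereal r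
                           \<partial>lebesgue_on {0..T}) powr (1 / real_of_ereal r)
       else ereal (norm (gauss_weierstrass T f))
              \<le> ereal C_obs * esssup (lebesgue_on {0..T})
                   (\<lambda>t. ereal (Cb_norm \<Omega> (obs \<Omega> (gauss_weierstrass t f)))))"
proof -
  note ne = thick_nonempty[OF assms(1)]
  obtain K where K: "0 \<le> K" and L1: "\<And>f :: (real ^ 'd) \<Rightarrow>\<^sub>C 'k. norm (gauss_weierstrass T f) \<le>
      K * (\<integral>t. Cb_norm \<Omega> (obs \<Omega> (gauss_weierstrass t f)) \<partial>lebesgue_on {0..T})"
    using thick_observability_L1[OF assms(1,2)] by metis
  have "if r < \<infinity>
       then norm (gauss_weierstrass T f)
              \<le> ((T + 1) * K) * (\<integral>t. Cb_norm \<Omega> (obs \<Omega> (gauss_weierstrass t f)) powr real_of_ereal r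
                           \<partial>lebesgue_on {0..T}) powr (1 / real_of_ereal r)
       else ereal (norm (gauss_weierstrass T f))
              \<le> ereal ((T + 1) * K) * esssup (lebesgue_on {0..T})
                   (\<lambda>t. ereal (Cb_norm \<Omega> (obs \<Omega> (gauss_weierstrass t f))))" for f :: "(real ^ 'd) \<Rightarrow>\<^sub>C 'k"
  proof -
    define g where "g t = Cb_norm \<Omega> (obs \<Omega> (gauss_weierstrass t f))" for t
    have g: "integrable (lebesgue_on {0..T}) g" "\<And>t. 0 \<le> g t"
      unfolding g_def by (intro integrable_Cb_norm_gauss_weierstrass Cb_norm_obs_nonneg ne)+
    have g_le: "g t \<le> norm f" for t
      unfolding g_def using Cb_norm_obs_le[OF ne] norm_gauss_weierstrass_le by (rule order.trans)
    show ?thesis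
    proof (cases "r < \<infinity>")
      case True
      define p where "p = real_of_ereal r"
      have p: "1 \<le> p" using True assms(3) unfolding p_def by (cases r) auto
      interpret finite_measure "lebesgue_on {0..T}" by (intro finite_measure_lebesgue_on) auto
      have "integrable (lebesgue_on {0..T}) (\<lambda>t. g t powr p)"
      proof (rule integrable_const_bound)
        show "AE t in lebesgue_on {0..T}. norm (g t powr p) \<le> norm f powr p"
          using g_le g(2) p by (intro AE_I2) (auto intro: powr_mono2)
        show "(\<lambda>t. g t powr p) \<in> borel_measurable (lebesgue_on {0..T})"
          using g(1) by measurable
      qed
      then have "K * (\<integral>t. g t \<partial>lebesgue_on {0..T}) \<le>
          K * ((T + 1) * (\<integral>t. g t powr p \<partial>lebesgue_on {0..T}) powr (1 / p))"
        using g p assms(2) K by (intro mult_left_mono integral_le_Lp_norm) auto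
      then show ?thesis
        using True L1[of f] by (simp add: g_def p_def mult_ac)
    next
      case False
      have "ereal (norm (gauss_weierstrass T f)) \<le> ereal (K * (\<integral>t. g t \<partial>lebesgue_on {0..T}))"
        using L1[of f] by (simp add: g_def)
      also note integral_le_esssup[OF g assms(2) K]
      finally show ?thesis using False by (simp add: g_def)
    qed
  qed
  moreover have "0 \<le> (T + 1) * K" using K assms(2) by simp
  ultimately show ?thesis by blast
qed

end
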